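(* Suppose that the band matrix $A=(A_{k,\ell})_{k,\ell\ge 0}$ (with entries in $\mathbb{C}^{N\times N}$, $A_{k,\ell}=O$ for $\ell<k-s$ or $\ell>k+r$, and $A_{k,k+r}$, $A_{k+s,k}$ invertible for all $k\ge 0$) satisfies $\sup_{i,j\ge 0}\|A_{i,j}\|<\infty$. Then $\lambda\in\mathbb{C}$ belongs to the resolvent set $\Omega(A)$ of the operator generated by $A$ if and only if there exist positive constants $C$ and $q<1$ and a matrix $\mathfrak{M}=(\mathfrak{M}_{i,j})_{i=1,\dots,r}^{j=1,\dots,s}$ with $\mathfrak{M}_{i,j}\in\mathbb{C}^{N\times N}$ such that $$\|R_{k,n}\|\le C\,q^{|n-k|},\qquad k,n\in\mathbb{Z}_+=\{0,1,2,\dots\},$$ where the matrices $R_{k,n}$ are built from $A$, $\lambda$ and $\mathfrak{M}$ as in the context. In this case, the matrix $\mathfrak{M}=\mathfrak{M}(\lambda)=(R_{i,j})_{i=0,\dots,r-1}^{j=0,\dots,s-1}$ is unique, and coincides with the Weyl matrix $\mathcal{M}(\lambda,A)$.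
   Context: Fix positive integers $N,r,s$; $E$ and $O$ are the unit and zero matrices of order $N$. $\|\cdot\|$ is a fixed matrix norm on $\mathbb{C}^{N\times N}$. $I_i$ and $\mathbf{0}_{i\times j}$ denote the identity and zero block matrices of block sizes $i\times i$ and $i\times j$, with blocks in $\mathbb{C}^{N\times N}$. Band matrix: $A=(A_{k,\ell})_{k,\ell=0}^\infty$, $A_{k,\ell}\in\mathbb{C}^{N\times N}$, where for all $k\ge 0$: $A_{k,\ell}=O$ if $\ell<k-s$ or $\ell>k+r$, and $A_{k,k+r}$, $A_{k+s,k}$ are invertible. Entries with a negative index are defined by: for $k\ge 0>\ell$, $A_{k,\ell}=-E$ if $k-\ell=s$ and $A_{k,\ell}=O$ otherwise; for $k<0\le \ell$, $A_{k,\ell}=-E$ if $\ell-k=r$ and $A_{k,\ell}=O$ otherwise. For $\lambda\in\mathbb{C}$ consider, for all $k\ge 0$, the difference equations for $Y_k,Y_k^+\in\mathbb{C}^{N\times N}$: (D1) $A_{k,k-s}Y_{k-s}+A_{k,k-s+1}Y_{k-s+1}+\dots+A_{k,k+r}Y_{k+r}=\lambda Y_k$, where $(Y_k)_{k\ge -s}$; (D2) $Y^+_{k-r}A_{k-r,k}+Y^+_{k-r+1}A_{k-r+1,k}+\dots+Y^+_{k+s}A_{k+s,k}=\lambda Y_k^+$, where $(Y^+_k)_{k\ge -r}$. Polynomial solutions: $Q_k(\lambda)=(Q_k^1(\lambda),\dots,Q_k^r(\lambda))$ and $P_k(\lambda)=(P_k^1(\lambda),\dots,P_k^s(\lambda))$,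 $k\ge -s$, are block rows each of whose components solves (D1); $Q_k^+(\lambda)$ is the block column with entries $Q_k^{1,+}(\lambda),\dots,Q_k^{s,+}(\lambda)$ and $P_k^+(\lambda)$ is the block column with entries $P_k^{1,+}(\lambda),\dots,P_k^{r,+}(\lambda)$, $k\ge -r$, each component solving (D2). All blocks are in $\mathbb{C}^{N\times N}$. Writing $Q_{j:k}$ (resp. $P_{j:k}$) for the block matrix with rows $Q_\ell$ (resp. $P_\ell$), $\ell=j,\dots,k$, and $Q^+_{j:k}$ (resp. $P^+_{j:k}$) for the block matrix with columns $Q^+_\ell$ (resp. $P_\ell^+$), $\ell=j,\dots,k$, they are determined by the initial conditions $Q_{0:r-1}=I_r$, $Q_{-s:-1}=\mathbf{0}_{s\times r}$, $P_{-s:-1}=I_s$, $P_{0:r-1}=\mathbf{0}_{r\times s}$; $Q^+_{0:s-1}=I_s$, $Q^+_{-r:-1}=\mathbf{0}_{s\times r}$, $P^+_{-r:-1}=I_r$, $P^+_{0:s-1}=\mathbf{0}_{r\times s}$. For an $r\times s$ block matrix $\mathfrak{M}$ with blocks in $\mathbb{C}^{N\times N}$ put $R_k(\lambda)=Q_k(\lambda)\mathfrak{M}-P_k(\lambda)$, $R_n^+(\lambda)=\mathfrak{M}Q_n^+(\lambda)-P_n^+(\lambda)$, and for $k,n\in\mathbb{Z}_+$ $R_{k,n}=Q_k(\lambda)R_n^+(\lambda)$ if $0\le k<n+r$, and $R_{k,n}=R_k(\lambda)Q_n^+(\lambda)$ if $0\le n<k+s$ (the two expressions coincide when both conditions hold).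 Operator: $l^2_N$ is the Hilbert space of square-summable sequences $u=(u_0,u_1,\dots)$ of column vectors $u_j\in\mathbb{C}^N$ with inner product $(u,v)=\sum_j v_j^*u_j$; under the boundedness assumption $A$ acts as a bounded operator on $l^2_N$. $\lambda\in\Omega(A)$ means that there is a bounded operator $\mathcal{R}(\lambda)=(\lambda I-A)^{-1}$ on $l^2_N$ with $(\lambda I-A)\mathcal{R}(\lambda)u=u$ and $\mathcal{R}(\lambda)(\lambda I-A)v=v$ for all $u,v\in l^2_N$. Write $\mathcal{R}(\lambda)=(\tilde R_{i,j})_{i,j=0}^\infty$ as an infinite matrix with entries $\tilde R_{i,j}\in\mathbb{C}^{N\times N}$. The Weyl matrix is $\mathcal{M}(\lambda,A)=(\tilde R_{i,j})_{i=0,\dots,r-1}^{j=0,\dots,s-1}$ (row index $i$, column index $j$). *)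

theory Defs
  imports "HOL-Analysis.Analysis"
begin

text \<open>
  The block order \<open>N\<close> is \<open>CARD('n)\<close>, so a block is an element of \<open>complex^'n^'n\<close>. Block indices
  of \<open>r\<times>s\<close> objects run over \<open>{0..<r}\<close> and \<open>{0..<s}\<close>. The product of a block or a column vector
  with a complex scalar \<open>c\<close> is written \<open>mat c ** X\<close> and \<open>c *s v\<close>, respectively.
\<close>

text \<open>Submultiplicativity is not required, so every norm on the complex vector space of blocks qualifies.\<close>

definition is_matrix_norm :: "(complex^'n^'n \<Rightarrow> real) \<Rightarrow> bool" where
  "is_matrix_norm \<nu> \<longleftrightarrow>
     (\<forall>X. 0 \<le> \<nu> X) \<and> (\<forall>X. \<nu> X = 0 \<longleftrightarrow> X = 0) \<and>
     (\<forall>c X. \<nu> (mat c ** X) = cmod c * \<nu> X) \<and>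
     (\<forall>X Y. \<nu> (X + Y) \<le> \<nu> X + \<nu> Y)"


subsection \<open>Band matrices and the difference equations\<close>

definition band_matrix :: "nat \<Rightarrow> nat \<Rightarrow> (nat \<Rightarrow> nat \<Rightarrow> complex^'n^'n) \<Rightarrow> bool" where
  "band_matrix r s A \<longleftrightarrow>
     (\<forall>k l. l + s < k \<or> k + r < l \<longrightarrow> A k l = 0) \<and>
     (\<forall>k. invertible (A k (k + r)) \<and> invertible (A (k + s) k))"

text \<open>
  The extension of \<open>A\<close> to integer indices. The value for two negative indices is a dummy: it does
  not occur in the difference equations.
\<close>

definition ext_entries ::
    "nat \<Rightarrow> nat \<Rightarrow> (nat \<Rightarrow> nat \<Rightarrow> complex^'n^'n) \<Rightarrow> int \<Rightarrow> int \<Rightarrow> complex^'n^'n" where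
  "ext_entries r s A k l =
     (if 0 \<le> k \<and> 0 \<le> l then A (nat k) (nat l)
      else if 0 \<le> k \<and> l < 0 then (if k - l = int s then - mat 1 else 0)
      else if k < 0 \<and> 0 \<le> l then (if l - k = int r then - mat 1 else 0)
      else 0)"

definition solves_D1 ::
    "nat \<Rightarrow> nat \<Rightarrow> (nat \<Rightarrow> nat \<Rightarrow> complex^'n^'n) \<Rightarrow> complex \<Rightarrow> (int \<Rightarrow> complex^'n^'n) \<Rightarrow> bool" where
  "solves_D1 r s A lam Y \<longleftrightarrow>
     (\<forall>k\<ge>0. (\<Sum>l = k - int s..k + int r. ext_entries r s A k l ** Y l) = mat lam ** Y k)"

definition solves_D2 ::
    "nat \<Rightarrow> nat \<Rightarrow> (nat \<Rightarrow> nat \<Rightarrow> complex^'n^'n) \<Rightarrow> complex \<Rightarrow> (int \<Rightarrow> complex^'n^'n) \<Rightarrow> bool" where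
  "solves_D2 r s A lam Y \<longleftrightarrow>
     (\<forall>k\<ge>0. (\<Sum>l = k - int r..k + int s. Y l ** ext_entries r s A l k) = mat lam ** Y k)"

text \<open>
  The solution of (D1) on \<open>k \<ge> - s\<close> with initial values \<open>Z k\<close>, \<open>- s \<le> k < r\<close>, and the solution of
  (D2) on \<open>k \<ge> - r\<close> with initial values \<open>Z k\<close>, \<open>- r \<le> k < s\<close>. The value \<open>0\<close> outside the range of
  the index only serves to make the sequence on all integers unique, see \<open>sol_D1_ex1\<close> and
  \<open>sol_D2_ex1\<close> below.
\<close>

definition sol_D1 ::
    "nat \<Rightarrow> nat \<Rightarrow> (nat \<Rightarrow> nat \<Rightarrow> complex^'n^'n) \<Rightarrow> complex \<Rightarrow> (int \<Rightarrow> complex^'n^'n) \<Rightarrow>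
     int \<Rightarrow> complex^'n^'n" where
  "sol_D1 r s A lam Z = (THE Y. solves_D1 r s A lam Y \<and>
     (\<forall>k. - int s \<le> k \<and> k < int r \<longrightarrow> Y k = Z k) \<and> (\<forall>k. k < - int s \<longrightarrow> Y k = 0))"

definition sol_D2 ::
    "nat \<Rightarrow> nat \<Rightarrow> (nat \<Rightarrow> nat \<Rightarrow> complex^'n^'n) \<Rightarrow> complex \<Rightarrow> (int \<Rightarrow> complex^'n^'n) \<Rightarrow>
     int \<Rightarrow> complex^'n^'n" where
  "sol_D2 r s A lam Z = (THE Y. solves_D2 r s A lam Y \<and>
     (\<forall>k. - int r \<le> k \<and> k < int s \<longrightarrow> Y k = Z k) \<and> (\<forall>k. k < - int r \<longrightarrow> Y k = 0))"

lemma fixpoint_ex1: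
  assumes adm: "adm_wf R F" and wf: "wf R"
  shows "\<exists>!Y. \<forall>k. Y k = F Y k"
proof (rule ex1I)
  show "\<forall>k. wfrec R F k = F (wfrec R F) k"
    using wfrec_fixpoint[OF wf adm] by metis
next
  fix Y assume Y: "\<forall>k. Y k = F Y k"
  show "Y = wfrec R F"
  proof
    fix k show "Y k = wfrec R F k"
      using wf
    proof (induction k rule: wf_induct_rule)
      case (less k)
      then have "F Y k = F (wfrec R F) k"
        using adm unfolding adm_wf_def by blast
      then show ?case
        using Y wfrec_fixpoint[OF wf adm] by metis
    qed
  qed
qed

lemma invertible_left_eq_iff:
  fixes B X Z :: "complex^'n^'n"
  assumes "invertible B"
  shows "B ** X = Z \<longleftrightarrow> X = matrix_inv B ** Z"
  using someI_ex[OF assms[unfolded invertible_def], folded matrix_inv_def] by (metis matrix_mul_assoc matrix_mul_lid)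

lemma invertible_right_eq_iff:
  fixes B X Z :: "complex^'n^'n"
  assumes "invertible B"
  shows "X ** B = Z \<longleftrightarrow> X = Z ** matrix_inv B"
  using someI_ex[OF assms[unfolded invertible_def], folded matrix_inv_def] by (metis matrix_mul_assoc matrix_mul_rid)

lemma recurrence_ex1:
  fixes p m :: nat and G :: "int \<Rightarrow> (int \<Rightarrow> 'a::zero) \<Rightarrow> 'a"
  assumes m: "0 < m"
    and local: "\<And>k Y Y'. 0 \<le> k \<Longrightarrow> (\<And>l. k - int p \<le> l \<Longrightarrow> l < k + int m \<Longrightarrow> Y l = Y' l) \<Longrightarrow> G k Y = G k Y'"
  shows "\<exists>!Y. (\<forall>k\<ge>0. Y (k + int m) = G k Y) \<and>
     (\<forall>k. - int p \<le> k \<and> k < int m \<longrightarrow> Y k = Z k) \<and> (\<forall>k. k < - int p \<longrightarrow> Y k = 0)"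
proof -
  let ?F = "\<lambda>Y k. if k < - int p then 0 else if k < int m then Z k else G (k - int m) Y"
  have adm: "adm_wf (int_ge_less_than (- int p)) ?F"
    unfolding adm_wf_def int_ge_less_than_def
    by (auto intro!: local)
  have eq: "(\<forall>k. Y k = ?F Y k) \<longleftrightarrow> (\<forall>k\<ge>0. Y (k + int m) = G k Y) \<and>
     (\<forall>k. - int p \<le> k \<and> k < int m \<longrightarrow> Y k = Z k) \<and> (\<forall>k. k < - int p \<longrightarrow> Y k = 0)" for Y
  proof (intro iffI conjI allI impI; (elim conjE)?)
    fix k :: int assume "\<forall>k. Y k = ?F Y k" "0 \<le> k"
    then show "Y (k + int m) = G k Y"
      by (auto dest!: spec[of _ "k + int m"])
  next
    fix k :: int assume "\<forall>k. Y k = ?F Y k" "- int p \<le> k" "k < int m"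
    then show "Y k = Z k" by (auto dest!: spec[of _ k])
  next
    fix k :: int assume "\<forall>k. Y k = ?F Y k" "k < - int p"
    then show "Y k = 0" by (auto dest!: spec[of _ k])
  next
    fix k :: int
    assume *: "\<forall>k\<ge>0. Y (k + int m) = G k Y"
      "\<forall>k. - int p \<le> k \<and> k < int m \<longrightarrow> Y k = Z k" "\<forall>k. k < - int p \<longrightarrow> Y k = 0"
    show "Y k = ?F Y k"
      using *(1)[rule_format, of "k - int m"] *(2,3) by auto
  qed
  show ?thesis
    using fixpoint_ex1[OF adm wf_int_ge_less_than] unfolding eq .
qed

lemma sol_D1_ex1:
  fixes A :: "nat \<Rightarrow> nat \<Rightarrow> complex^'n^'n"
  assumes A: "band_matrix r s A" and r: "0 < r"
  shows "\<exists>!Y. solves_D1 r s A lam Y \<and>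
     (\<forall>k. - int s \<le> k \<and> k < int r \<longrightarrow> Y k = Z k) \<and> (\<forall>k. k < - int s \<longrightarrow> Y k = 0)"
proof -
  let ?G = "\<lambda>k Y. matrix_inv (ext_entries r s A k (k + int r)) **
     (mat lam ** Y k - (\<Sum>l = k - int s..<k + int r. ext_entries r s A k l ** Y l))"
  have eq: "solves_D1 r s A lam Y \<longleftrightarrow> (\<forall>k\<ge>0. Y (k + int r) = ?G k Y)" for Y
    unfolding solves_D1_def
  proof (intro all_cong1 imp_cong refl)
    fix k :: int assume k: "0 \<le> k"
    have inv: "invertible (ext_entries r s A k (k + int r))"
      using A k by (simp add: ext_entries_def band_matrix_def nat_add_distrib)
    have "{k - int s..k + int r} = insert (k + int r) {k - int s..<k + int r}" by auto
    then have "(\<Sum>l = k - int s..k + int r. ext_entries r s A k l ** Y l) =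
       ext_entries r s A k (k + int r) ** Y (k + int r) +
       (\<Sum>l = k - int s..<k + int r. ext_entries r s A k l ** Y l)"
      by simp
    then show "((\<Sum>l = k - int s..k + int r. ext_entries r s A k l ** Y l) = mat lam ** Y k) =
       (Y (k + int r) = ?G k Y)"
      by (simp only: invertible_left_eq_iff[OF inv, symmetric] eq_diff_eq)
  qed
  show ?thesis
    unfolding eq by (rule recurrence_ex1) (use r in \<open>auto intro!: sum.cong arg_cong2[of _ _ _ _ "(-)"] arg_cong2[of _ _ _ _ "(**)"]\<close>)
qed

lemma sol_D2_ex1:
  fixes A :: "nat \<Rightarrow> nat \<Rightarrow> complex^'n^'n"
  assumes A: "band_matrix r s A" and s: "0 < s"
  shows "\<exists>!Y. solves_D2 r s A lam Y \<and>
     (\<forall>k. - int r \<le> k \<and> k < int s \<longrightarrow> Y k = Z k) \<and> (\<forall>k. k < - int r \<longrightarrow> Y k = 0)"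
proof -
  let ?G = "\<lambda>k Y. (mat lam ** Y k - (\<Sum>l = k - int r..<k + int s. Y l ** ext_entries r s A l k)) **
     matrix_inv (ext_entries r s A (k + int s) k)"
  have eq: "solves_D2 r s A lam Y \<longleftrightarrow> (\<forall>k\<ge>0. Y (k + int s) = ?G k Y)" for Y
    unfolding solves_D2_def
  proof (intro all_cong1 imp_cong refl)
    fix k :: int assume k: "0 \<le> k"
    have inv: "invertible (ext_entries r s A (k + int s) k)"
      using A k by (simp add: ext_entries_def band_matrix_def nat_add_distrib)
    have "{k - int r..k + int s} = insert (k + int s) {k - int r..<k + int s}" by auto
    then have "(\<Sum>l = k - int r..k + int s. Y l ** ext_entries r s A l k) =
       Y (k + int s) ** ext_entries r s A (k + int s) k +
       (\<Sum>l = k - int r..<k + int s. Y l ** ext_entries r s A l k)"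
      by simp
    then show "((\<Sum>l = k - int r..k + int s. Y l ** ext_entries r s A l k) = mat lam ** Y k) =
       (Y (k + int s) = ?G k Y)"
      by (simp only: invertible_right_eq_iff[OF inv, symmetric] eq_diff_eq)
  qed
  show ?thesis
    unfolding eq by (rule recurrence_ex1) (use s in \<open>auto intro!: sum.cong arg_cong2[of _ _ _ _ "(-)"] arg_cong2[of _ _ _ _ "(**)"]\<close>)
qed


subsection \<open>The polynomial solutions and the matrices \<open>R\<^bsub>k,n\<^esub>\<close>\<close>

text \<open>
  The last argument is the sequence index \<open>k\<close>, the one before it is the component within the block
  row (for \<open>Q\<close>, \<open>P\<close>) or the block column (for \<open>Q\<^sup>+\<close>, \<open>P\<^sup>+\<close>): it ranges over \<open>{0..<r}\<close> for \<open>Q\<close> and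
  \<open>P\<^sup>+\<close>, and over \<open>{0..<s}\<close> for \<open>P\<close> and \<open>Q\<^sup>+\<close>. The initial values are the entries of the identity
  block matrices; e.g. \<open>P\<^bsub>-s:-1\<^esub> = I\<^sub>s\<close> has \<open>E\<close> in row \<open>k = j - s\<close> of column \<open>j\<close>.
\<close>

definition Q_sol where
  "Q_sol r s A lam i = sol_D1 r s A lam (\<lambda>k. if k = int i then mat 1 else 0)"

definition P_sol where
  "P_sol r s A lam j = sol_D1 r s A lam (\<lambda>k. if k = int j - int s then mat 1 else 0)"

definition Qp_sol where
  "Qp_sol r s A lam j = sol_D2 r s A lam (\<lambda>k. if k = int j then mat 1 else 0)"

definition Pp_sol where
  "Pp_sol r s A lam i = sol_D2 r s A lam (\<lambda>k. if k = int i - int r then mat 1 else 0)"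

text \<open>\<open>r\<times>s\<close> block matrices, represented with zero blocks outside the index range.\<close>

definition block_matrices :: "nat \<Rightarrow> nat \<Rightarrow> (nat \<Rightarrow> nat \<Rightarrow> complex^'n^'n) set" where
  "block_matrices r s = {M. \<forall>i j. \<not> (i < r \<and> j < s) \<longrightarrow> M i j = 0}"

text \<open>The \<open>j\<close>-th block, \<open>j < s\<close>, of the block row \<open>R\<^sub>k = Q\<^sub>k M - P\<^sub>k\<close>.\<close>

definition R_row where
  "R_row r s A lam M k j =
     (\<Sum>i<r. Q_sol r s A lam i (int k) ** M i j) - P_sol r s A lam j (int k)"

text \<open>The \<open>i\<close>-th block, \<open>i < r\<close>, of the block column \<open>R\<^sub>n\<^sup>+ = M Q\<^sub>n\<^sup>+ - P\<^sub>n\<^sup>+\<close>.\<close>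

definition Rp_col where
  "Rp_col r s A lam M n i =
     (\<Sum>j<s. M i j ** Qp_sol r s A lam j (int n)) - Pp_sol r s A lam i (int n)"

text \<open>
  For \<open>r, s > 0\<close>, if \<open>k \<ge> n + r\<close> then \<open>n < k + s\<close>, so the second expression is used within its range.
  For a band matrix the two expressions agree where both \<open>k < n + r\<close> and \<open>n < k + s\<close>.
\<close>

definition R_entry ::
    "nat \<Rightarrow> nat \<Rightarrow> (nat \<Rightarrow> nat \<Rightarrow> complex^'n^'n) \<Rightarrow> complex \<Rightarrow> (nat \<Rightarrow> nat \<Rightarrow> complex^'n^'n) \<Rightarrow>
     nat \<Rightarrow> nat \<Rightarrow> complex^'n^'n" where
  "R_entry r s A lam M k n =
     (if k < n + r then (\<Sum>i<r. Q_sol r s A lam i (int k) ** Rp_col r s A lam M n i)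
      else (\<Sum>j<s. R_row r s A lam M k j ** Qp_sol r s A lam j (int n)))"

definition exp_decay where
  "exp_decay \<nu> r s A lam M \<longleftrightarrow> (\<exists>C q. 0 < C \<and> 0 < q \<and> q < 1 \<and>
     (\<forall>k n. \<nu> (R_entry r s A lam M k n) \<le> C * q ^ nat \<bar>int n - int k\<bar>))"


subsection \<open>The operator on \<open>l\<^sup>2\<^sub>N\<close> and its resolvent\<close>

definition l2_space :: "(nat \<Rightarrow> complex^'n) set" where
  "l2_space = {u. summable (\<lambda>j. (norm (u j))\<^sup>2)}"

definition l2_norm :: "(nat \<Rightarrow> complex^'n) \<Rightarrow> real" where
  "l2_norm u = sqrt (\<Sum>j. (norm (u j))\<^sup>2)"

definition bounded_l2_operator :: "((nat \<Rightarrow> complex^'n) \<Rightarrow> nat \<Rightarrow> complex^'n) \<Rightarrow> bool" where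
  "bounded_l2_operator T \<longleftrightarrow>
     (\<forall>u\<in>l2_space. T u \<in> l2_space) \<and>
     (\<forall>u\<in>l2_space. \<forall>v\<in>l2_space. \<forall>c. \<forall>k. T (\<lambda>j. c *s u j + v j) k = c *s T u k + T v k) \<and>
     (\<exists>K. \<forall>u\<in>l2_space. l2_norm (T u) \<le> K * l2_norm u)"

definition matrix_op ::
    "(nat \<Rightarrow> nat \<Rightarrow> complex^'n^'n) \<Rightarrow> (nat \<Rightarrow> complex^'n) \<Rightarrow> nat \<Rightarrow> complex^'n" where
  "matrix_op A u k = (\<Sum>l. A k l *v u l)"

definition is_resolvent ::
    "(nat \<Rightarrow> nat \<Rightarrow> complex^'n^'n) \<Rightarrow> complex \<Rightarrow> ((nat \<Rightarrow> complex^'n) \<Rightarrow> nat \<Rightarrow> complex^'n) \<Rightarrow> bool" where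
  "is_resolvent A lam T \<longleftrightarrow> bounded_l2_operator T \<and>
     (\<forall>u\<in>l2_space. (\<lambda>k. lam *s T u k - matrix_op A (T u) k) = u) \<and>
     (\<forall>v\<in>l2_space. T (\<lambda>k. lam *s v k - matrix_op A v k) = v)"

definition resolvent_set :: "(nat \<Rightarrow> nat \<Rightarrow> complex^'n^'n) \<Rightarrow> complex set" where
  "resolvent_set A = {lam. \<exists>T. is_resolvent A lam T}"

text \<open>For bounded \<open>A\<close>, a resolvent is uniquely determined on \<open>l2_space\<close>, but arbitrary outside.\<close>

definition resolvent_op ::
    "(nat \<Rightarrow> nat \<Rightarrow> complex^'n^'n) \<Rightarrow> complex \<Rightarrow> (nat \<Rightarrow> complex^'n) \<Rightarrow> nat \<Rightarrow> complex^'n" where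
  "resolvent_op A lam = (SOME T. is_resolvent A lam T)"

text \<open>
  The block in position \<open>(i, j)\<close> of the infinite matrix of \<open>T\<close>: its column \<open>b\<close> is the \<open>i\<close>-th
  component of the image of the sequence with the unit vector \<open>axis b 1\<close> in place \<open>j\<close>.
\<close>

definition op_entry ::
    "((nat \<Rightarrow> complex^'n) \<Rightarrow> nat \<Rightarrow> complex^'n) \<Rightarrow> nat \<Rightarrow> nat \<Rightarrow> complex^'n^'n" where
  "op_entry T i j = (\<chi> a b. T (\<lambda>m. if m = j then axis b 1 else 0) i $ a)"

definition weyl_matrix ::
    "nat \<Rightarrow> nat \<Rightarrow> (nat \<Rightarrow> nat \<Rightarrow> complex^'n^'n) \<Rightarrow> complex \<Rightarrow> nat \<Rightarrow> nat \<Rightarrow> complex^'n^'n" where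
  "weyl_matrix r s A lam i j = (if i < r \<and> j < s then op_entry (resolvent_op A lam) i j else 0)"

end

theory Submission
  imports Defs
begin

text \<open>
  Put \<open>B = \<lambda>I - A\<close>. The proof separates the purely algebraic question which infinite matrices \<open>X\<close>
  satisfy \<open>B X = I = X B\<close> entrywise (all sums are finite, since \<open>B\<close> is a band matrix) from the
  question which of them act boundedly on \<open>l\<^sup>2\<close>.

  \<^emph>\<open>Algebra.\<close> Since \<open>A\<^bsub>k,k+r\<^esub>\<close> is invertible, a column \<open>Y\<close> is determined by \<open>B Y\<close> and by its first \<open>r\<close>
  blocks; dually, a row \<open>Y\<close> is determined by \<open>Y B\<close> and its first \<open>s\<close> blocks. In these terms the
  initial conditions say that \<open>B Q = 0\<close> with \<open>Q\<close> starting from the identity, while \<open>B P\<close> is minus the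
  first \<open>s\<close> columns of the identity with \<open>P\<close> starting from zero. Hence a two-sided formal inverse with
  upper left corner \<open>M\<close> can only be the matrix of the \<open>R\<^bsub>k,n\<^esub>\<close> (\<open>formal_inverse_eq_R_entry\<close>). Conversely
  every \<open>M\<close> occurs as a corner (\<open>formal_inverse_exists\<close>): solve \<open>B X = I\<close> column by column from the initial
  rows \<open>R\<^sup>+\<close>; then \<open>B (X B - I) = 0\<close>, and \<open>X B - I\<close> vanishes in the first \<open>r\<close> rows, so it vanishes.
  So the matrices \<open>(R\<^bsub>k,n\<^esub>)\<close> are exactly the formal inverses of \<open>B\<close>, parametrized by their corners \<open>M\<close>.

  \<^emph>\<open>Analysis.\<close> If the \<open>R\<^bsub>k,n\<^esub>\<close> decay exponentially, the Schur test makes them the matrix of a bounded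
  operator. A bounded operator is determined by its matrix (\<open>bounded_l2_operator_expansion\<close>), so
  the formal identities \<open>B R = I = R B\<close> become operator identities and the operator is the resolvent
  (\<open>is_resolvent_matrix_op\<close>). Conversely, the matrix of a resolvent is a formal inverse, hence it is
  \<open>(R\<^bsub>k,n\<^esub>)\<close> for its own corner, the Weyl matrix. Its exponential decay is a Combes-Thomas estimate
  (\<open>resolvent_decays\<close>): conjugating \<open>A\<close> by slowly growing exponential weights is a perturbation that is
  small in operator norm, because \<open>A\<close> is a bounded band matrix. Uniqueness of \<open>M\<close> is uniqueness of the
  resolvent.
\<close>

section \<open>Matrices over the complex numbers\<close>

lemma matrix_mult_sum_right: "X ** (\<Sum>i\<in>I. f i) = (\<Sum>i\<in>I. X ** f i)"
  for X :: "complex^'n^'n"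
  by (induction I rule: infinite_finite_induct) (auto simp: matrix_add_ldistrib)

lemma matrix_mult_sum_left: "(\<Sum>i\<in>I. f i) ** X = (\<Sum>i\<in>I. f i ** X)"
  for X :: "complex^'n^'n"
  by (simp add: matrix_matrix_mult_def vec_eq_iff sum_distrib_right sum.swap[of _ I])

lemma matrix_mult_diff_right: "X ** (Y - Z) = X ** Y - X ** Z" for X :: "complex^'n^'n"
  by (simp add: matrix_matrix_mult_def vec_eq_iff right_diff_distrib sum_subtractf)

lemma matrix_mult_diff_left: "(Y - Z) ** X = Y ** X - Z ** X" for X :: "complex^'n^'n"
  by (simp add: matrix_matrix_mult_def vec_eq_iff left_diff_distrib sum_subtractf)

lemma matrix_mult_minus_right: "X ** (- Y) = - (X ** Y)" for X :: "complex^'n^'n"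
  by (simp add: matrix_matrix_mult_def vec_eq_iff sum_negf)

lemma matrix_mult_minus_left: "(- Y) ** X = - (Y ** X)" for X :: "complex^'n^'n"
  by (simp add: matrix_matrix_mult_def vec_eq_iff sum_negf)

lemma mat_mult_nth: "(mat c ** X) $ a $ b = c * X $ a $ b" for X :: "complex^'n^'n"
proof -
  have "(mat c ** X) $ a $ b = (\<Sum>k\<in>UNIV. if a = k then c * X $ k $ b else 0)"
    by (simp add: matrix_matrix_mult_def mat_def if_distrib[of "\<lambda>x. x * _"] cong: if_cong)
  then show ?thesis by simp
qed

lemma mult_mat_commute: "X ** mat c = mat c ** X" for X :: "complex^'n^'n"
proof -
  have "(X ** mat c) $ a $ b = c * X $ a $ b" for a b
  proof -
    have "(X ** mat c) $ a $ b = (\<Sum>k\<in>UNIV. if k = b then X $ a $ k * c else 0)"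
      by (simp add: matrix_matrix_mult_def mat_def if_distrib[of "\<lambda>x. _ * x"] cong: if_cong)
    then show ?thesis by (simp add: mult.commute)
  qed
  then show ?thesis by (simp add: vec_eq_iff mat_mult_nth)
qed

lemma transpose_sum: "transpose (\<Sum>i\<in>I. f i) = (\<Sum>i\<in>I. transpose (f i))"
  for f :: "'i \<Rightarrow> complex^'n^'n"
  by (simp add: transpose_def vec_eq_iff)

lemma transpose_arith:
  fixes X Y :: "complex^'n^'n"
  shows "transpose (X - Y) = transpose X - transpose Y" "transpose (- X) = - transpose X"
    "transpose (0 :: complex^'n^'n) = 0"
  by (simp_all add: transpose_def vec_eq_iff)

lemma invertible_transpose: "invertible (transpose X)" if "invertible X" for X :: "complex^'n^'n"
  using that unfolding invertible_def by (metis matrix_transpose_mul transpose_mat)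

lemma mat_mult_vec: "mat c *v v = c *s v" for v :: "complex^'n"
  by (simp add: vec_eq_iff matrix_vector_mult_def mat_def if_distrib[of "\<lambda>x. x * _"] cong: if_cong)

lemma sum_matrix_vector_mult: "(\<Sum>i\<in>I. X i) *v v = (\<Sum>i\<in>I. X i *v v)" for X :: "'i \<Rightarrow> complex^'n^'n"
  by (induction I rule: infinite_finite_induct) (auto simp: matrix_vector_mult_add_rdistrib)

section \<open>Formal inverses of the band matrix\<close>

locale band_pencil =
  fixes r s :: nat and A :: "nat \<Rightarrow> nat \<Rightarrow> complex^'n^'n" and lam :: complex
  assumes r_pos: "0 < r" and s_pos: "0 < s" and band: "band_matrix r s A"
begin

definition B :: "nat \<Rightarrow> nat \<Rightarrow> complex^'n^'n" where
  "B k l = (if k = l then mat lam else 0) - A k l"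

lemma A_zero: "l + s < k \<or> k + r < l \<Longrightarrow> A k l = 0"
  using band by (auto simp: band_matrix_def)

lemma B_zero: "l + s < k \<or> k + r < l \<Longrightarrow> B k l = 0"
  by (auto simp: B_def A_zero)

lemma invertible_B: "invertible (B k (k + r))"
proof -
  have "invertible (A k (k + r))" using band by (auto simp: band_matrix_def)
  then obtain C where "A k (k + r) ** C = mat 1" "C ** A k (k + r) = mat 1"
    by (auto simp: invertible_def)
  then show ?thesis using r_pos unfolding invertible_def
    by (intro exI[of _ "- C"]) (simp add: B_def matrix_mult_minus_left matrix_mult_minus_right)
qed

text \<open>
  The \<open>k\<close>-th equation is solved for the block with index \<open>k + r\<close>. The version with finitely many
  equations is needed because column \<open>n\<close> of an inverse solves the homogeneous equations for \<open>k < n\<close> only.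
\<close>

lemma recurrence_unique:
  fixes Y Y' :: "nat \<Rightarrow> complex^'n^'n"
  assumes eq: "\<And>k. k < n \<Longrightarrow> (\<Sum>l\<le>k + r. B k l ** Y l) = (\<Sum>l\<le>k + r. B k l ** Y' l)"
    and init: "\<And>i. i < r \<Longrightarrow> Y i = Y' i"
    and k: "k < n + r"
  shows "Y k = Y' k"
  using k
proof (induction k rule: less_induct)
  case (less k)
  show ?case
  proof (cases "k < r")
    case False
    then obtain m where m: "k = m + r" by (metis add.commute le_Suc_ex not_less)
    have ins: "{..m + r} = insert (m + r) {..<m + r}" by auto
    have "(\<Sum>l<m + r. B m l ** Y l) = (\<Sum>l<m + r. B m l ** Y' l)"
      using less m by (intro sum.cong) auto
    with eq[of m] have "B m (m + r) ** Y (m + r) = B m (m + r) ** Y' (m + r)"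
      using less.prems m by (simp add: ins)
    then show ?thesis
      using invertible_left_eq_iff[OF invertible_B, of m _ "B m (m + r) ** Y' (m + r)"] m by metis
  qed (rule init)
qed

lemma recurrence_exists:
  fixes F Z :: "nat \<Rightarrow> complex^'n^'n"
  shows "\<exists>Y. (\<forall>i<r. Y i = Z i) \<and> (\<forall>k. (\<Sum>l\<le>k + r. B k l ** Y l) = F k)"
proof -
  let ?G = "\<lambda>Y k. if k < r then Z k
    else matrix_inv (B (k - r) k) ** (F (k - r) - (\<Sum>l<k. B (k - r) l ** Y l))"
  have "adm_wf less_than ?G"
    unfolding adm_wf_def
  proof (intro allI impI)
    fix Y Y' :: "nat \<Rightarrow> complex^'n^'n" and k assume "\<forall>z. (z, k) \<in> less_than \<longrightarrow> Y z = Y' z"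
    then have "(\<Sum>l<k. B (k - r) l ** Y l) = (\<Sum>l<k. B (k - r) l ** Y' l)"
      by (intro sum.cong) auto
    then show "?G Y k = ?G Y' k" by simp
  qed
  then obtain Y where Y: "\<forall>k. Y k = ?G Y k"
    using fixpoint_ex1[OF _ wf_less_than] by blast
  have "(\<Sum>l\<le>k + r. B k l ** Y l) = F k" for k
  proof -
    have ins: "{..k + r} = insert (k + r) {..<k + r}" by auto
    have "Y (k + r) = matrix_inv (B k (k + r)) ** (F k - (\<Sum>l<k + r. B k l ** Y l))"
      using Y[rule_format, of "k + r"] by simp
    then have "B k (k + r) ** Y (k + r) = F k - (\<Sum>l<k + r. B k l ** Y l)"
      using invertible_left_eq_iff[OF invertible_B] by metis
    then show ?thesis by (simp add: ins)
  qed
  moreover have "\<forall>i<r. Y i = Z i" using Y by auto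
  ultimately show ?thesis by blast
qed

text \<open>
  Passing from (D1) to the semi-infinite matrix \<open>B\<close>, the initial values with negative index become an
  inhomogeneity in the first \<open>s\<close> equations. The point of setting \<open>A\<^bsub>k,k-s\<^esub> = - E\<close> is that the value with
  index \<open>k - s\<close> enters equation \<open>k\<close> only.
\<close>

lemma solves_D1_iff:
  "solves_D1 r s A lam Y \<longleftrightarrow>
    (\<forall>k. (\<Sum>l\<le>k + r. B k l ** Y (int l)) = (if k < s then - Y (int k - int s) else 0))"
proof -
  have "((\<Sum>l = int k - int s..int k + int r. ext_entries r s A (int k) l ** Y l) = mat lam ** Y (int k)) \<longleftrightarrow>
    ((\<Sum>l\<le>k + r. B k l ** Y (int l)) = (if k < s then - Y (int k - int s) else 0))" for k
  proof -
    let ?f = "\<lambda>l. ext_entries r s A (int k) l ** Y l"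
    let ?S = "{int k - int s..int k + int r}"
    have "sum ?f ?S = sum ?f (?S \<inter> {..<0}) + sum ?f (?S \<inter> {0..})"
      by (subst sum.union_disjoint[symmetric]) (auto intro!: sum.cong)
    moreover have "sum ?f (?S \<inter> {..<0}) = (if k < s then - Y (int k - int s) else 0)"
    proof -
      have "sum ?f (?S \<inter> {..<0}) = (\<Sum>l\<in>?S \<inter> {..<0}. if l = int k - int s then - Y l else 0)"
        by (intro sum.cong) (auto simp: ext_entries_def matrix_mult_minus_left)
      also have "\<dots> = (if k < s then - Y (int k - int s) else 0)"
        by (subst sum.delta) auto
      finally show ?thesis .
    qed
    moreover have "sum ?f (?S \<inter> {0..}) = (\<Sum>l\<le>k + r. A k l ** Y (int l))"
    proof -
      have "(\<Sum>l\<le>k + r. A k l ** Y (int l)) = sum ?f (int ` {..k + r})"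
        by (simp add: sum.reindex ext_entries_def)
      also have "\<dots> = sum ?f (?S \<inter> {0..})"
      proof (rule sum.mono_neutral_right)
        show "?S \<inter> {0..} \<subseteq> int ` {..k + r}"
          by (auto intro!: image_eqI[where x = "nat _"])
        show "\<forall>i\<in>int ` {..k + r} - ?S \<inter> {0..}. ?f i = 0"
          by (auto simp: ext_entries_def A_zero)
      qed auto
      finally show ?thesis by simp
    qed
    moreover have "(\<Sum>l\<le>k + r. B k l ** Y (int l)) = mat lam ** Y (int k) - (\<Sum>l\<le>k + r. A k l ** Y (int l))"
    proof -
      have "(\<Sum>l\<le>k + r. (if k = l then mat lam else 0) ** Y (int l)) =
         (\<Sum>l\<le>k + r. if k = l then mat lam ** Y (int l) else 0)"
        by (intro sum.cong) auto
      then show ?thesis by (simp add: B_def matrix_mult_diff_left sum_subtractf)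
    qed
    moreover have "(a = m) \<longleftrightarrow> (b = c)" if "a = c + t" "b = m - t" for a b c m t :: "complex^'n^'n"
      using that by (auto simp: algebra_simps)
    ultimately show ?thesis by simp
  qed
  moreover have "(\<forall>k\<ge>0. P k) \<longleftrightarrow> (\<forall>k. P (int k))" for P
    by (metis nonneg_int_cases of_nat_0_le_iff)
  ultimately show ?thesis unfolding solves_D1_def by simp
qed

lemma sol_D1_spec:
  shows "solves_D1 r s A lam (sol_D1 r s A lam Z)"
    and "\<And>k. - int s \<le> k \<Longrightarrow> k < int r \<Longrightarrow> sol_D1 r s A lam Z k = Z k"
  using theI'[OF sol_D1_ex1[OF band r_pos, of lam Z], folded sol_D1_def] by auto

lemma Q_sol_recurrence: "(\<Sum>l\<le>k + r. B k l ** Q_sol r s A lam i (int l)) = 0"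
  using sol_D1_spec(1)[unfolded solves_D1_iff, rule_format, of k]
  by (auto simp: Q_sol_def sol_D1_spec(2))

lemma Q_sol_init: "i' < r \<Longrightarrow> Q_sol r s A lam i (int i') = (if i' = i then mat 1 else 0)"
  by (simp add: Q_sol_def sol_D1_spec(2))

lemma P_sol_recurrence:
  "j < s \<Longrightarrow> (\<Sum>l\<le>k + r. B k l ** P_sol r s A lam j (int l)) = (if k = j then - mat 1 else 0)"
  using sol_D1_spec(1)[unfolded solves_D1_iff, rule_format, of k]
  by (auto simp: P_sol_def sol_D1_spec(2))

lemma P_sol_init: "i < r \<Longrightarrow> j < s \<Longrightarrow> P_sol r s A lam j (int i) = 0"
  by (simp add: P_sol_def sol_D1_spec(2))

text \<open>
  Transposition exchanges (D1) and (D2), together with \<open>r\<close> and \<open>s\<close>, and thus carries every fact about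
  columns over to rows.
\<close>

lemma band_pencil_transpose: "band_pencil s r (\<lambda>k l. transpose (A l k))"
  using band r_pos s_pos
  by unfold_locales (auto simp: band_matrix_def invertible_transpose transpose_arith)

lemma B_transpose: "band_pencil.B (\<lambda>k l. transpose (A l k)) lam k l = transpose (B l k)"
proof -
  interpret T: band_pencil s r "\<lambda>k l. transpose (A l k)" lam by (rule band_pencil_transpose)
  show ?thesis by (simp add: T.B_def B_def transpose_arith)
qed

lemma sum_B_transpose:
  fixes Y :: "nat \<Rightarrow> complex^'n^'n"
  shows "(\<Sum>l\<le>k + s. band_pencil.B (\<lambda>k l. transpose (A l k)) lam k l ** transpose (Y l)) =
    transpose (\<Sum>l\<le>k + s. Y l ** B l k)"
  by (simp add: B_transpose transpose_sum matrix_transpose_mul)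

lemma left_recurrence_unique:
  fixes Y Y' :: "nat \<Rightarrow> complex^'n^'n"
  assumes eq: "\<And>k. k < n \<Longrightarrow> (\<Sum>l\<le>k + s. Y l ** B l k) = (\<Sum>l\<le>k + s. Y' l ** B l k)"
    and init: "\<And>j. j < s \<Longrightarrow> Y j = Y' j"
    and k: "k < n + s"
  shows "Y k = Y' k"
proof -
  interpret T: band_pencil s r "\<lambda>k l. transpose (A l k)" lam by (rule band_pencil_transpose)
  have "transpose (Y k) = transpose (Y' k)"
    by (rule T.recurrence_unique[where n = n]) (simp_all add: sum_B_transpose eq init k)
  then show ?thesis by simp
qed

lemma solves_D2_transpose:
  "solves_D2 r s A lam Y \<longleftrightarrow> solves_D1 s r (\<lambda>k l. transpose (A l k)) lam (\<lambda>k. transpose (Y k))"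
proof -
  have ext: "ext_entries s r (\<lambda>k l. transpose (A l k)) k l = transpose (ext_entries r s A l k)" for k l
    unfolding ext_entries_def if_distrib[of transpose] transpose_arith transpose_mat linorder_not_le[symmetric, of 0]
    by (cases "0 \<le> k"; cases "0 \<le> l"; simp only: simp_thms if_True if_False)
  have sums: "(\<Sum>l\<in>S. transpose (ext_entries r s A l k) ** transpose (Y l)) =
     transpose (\<Sum>l\<in>S. Y l ** ext_entries r s A l k)" for S k
    unfolding transpose_sum matrix_transpose_mul ..
  have "mat lam ** transpose X = transpose (mat lam ** X)" for X :: "complex^'n^'n"
    unfolding matrix_transpose_mul transpose_mat mult_mat_commute ..
  then show ?thesis
    unfolding solves_D1_def solves_D2_def ext sums by (simp only: transpose_iff)
qed

lemma sol_D2_transpose: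
  "transpose (sol_D2 r s A lam Z k) =
    sol_D1 s r (\<lambda>k l. transpose (A l k)) lam (\<lambda>k. transpose (Z k)) k"
proof -
  interpret T: band_pencil s r "\<lambda>k l. transpose (A l k)" lam by (rule band_pencil_transpose)
  let ?Y = "\<lambda>k. transpose (sol_D2 r s A lam Z k)"
  note D2 = theI'[OF sol_D2_ex1[OF band s_pos, of lam Z], folded sol_D2_def]
  have "solves_D1 s r (\<lambda>k l. transpose (A l k)) lam ?Y \<and>
     (\<forall>k. - int r \<le> k \<and> k < int s \<longrightarrow> ?Y k = transpose (Z k)) \<and> (\<forall>k. k < - int r \<longrightarrow> ?Y k = 0)"
    using D2 by (simp add: solves_D2_transpose[symmetric] transpose_arith)
  then have "sol_D1 s r (\<lambda>k l. transpose (A l k)) lam (\<lambda>k. transpose (Z k)) = ?Y"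
    unfolding sol_D1_def by (rule the1_equality[OF sol_D1_ex1[OF T.band s_pos]])
  then show ?thesis by simp
qed

lemma Qp_sol_transpose:
  "transpose (Qp_sol r s A lam j k) = Q_sol s r (\<lambda>k l. transpose (A l k)) lam j k"
  by (simp add: Qp_sol_def Q_sol_def sol_D2_transpose if_distrib[of transpose] transpose_arith cong: if_cong)

lemma Pp_sol_transpose:
  "transpose (Pp_sol r s A lam i k) = P_sol s r (\<lambda>k l. transpose (A l k)) lam i k"
  by (simp add: Pp_sol_def P_sol_def sol_D2_transpose if_distrib[of transpose] transpose_arith cong: if_cong)

lemma Qp_sol_recurrence: "(\<Sum>l\<le>k + s. Qp_sol r s A lam j (int l) ** B l k) = 0"
  and Qp_sol_init: "j' < s \<Longrightarrow> Qp_sol r s A lam j (int j') = (if j' = j then mat 1 else 0)"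
  and Pp_sol_recurrence:
    "i < r \<Longrightarrow> (\<Sum>l\<le>k + s. Pp_sol r s A lam i (int l) ** B l k) = (if k = i then - mat 1 else 0)"
  and Pp_sol_init: "j' < s \<Longrightarrow> i < r \<Longrightarrow> Pp_sol r s A lam i (int j') = 0"
proof -
  interpret T: band_pencil s r "\<lambda>k l. transpose (A l k)" lam by (rule band_pencil_transpose)
  show "(\<Sum>l\<le>k + s. Qp_sol r s A lam j (int l) ** B l k) = 0"
    using T.Q_sol_recurrence[of k j]
    by (subst transpose_iff[symmetric]) (simp del: transpose_iff add: Qp_sol_transpose[symmetric] sum_B_transpose transpose_arith)
  show "j' < s \<Longrightarrow> Qp_sol r s A lam j (int j') = (if j' = j then mat 1 else 0)"
    using T.Q_sol_init[of j' j]
    by (subst transpose_iff[symmetric]) (simp del: transpose_iff add: Qp_sol_transpose transpose_arith)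
  show "i < r \<Longrightarrow> (\<Sum>l\<le>k + s. Pp_sol r s A lam i (int l) ** B l k) = (if k = i then - mat 1 else 0)"
    using T.P_sol_recurrence[of i k]
    by (subst transpose_iff[symmetric])
      (simp del: transpose_iff add: Pp_sol_transpose[symmetric] sum_B_transpose transpose_arith)
  show "j' < s \<Longrightarrow> i < r \<Longrightarrow> Pp_sol r s A lam i (int j') = 0"
    using T.P_sol_init[of j' i]
    by (subst transpose_iff[symmetric]) (simp del: transpose_iff add: Pp_sol_transpose transpose_arith)
qed

text \<open>The summation ranges contain the band, so these are the full entries of the products.\<close>

definition formal_inverse :: "(nat \<Rightarrow> nat \<Rightarrow> complex^'n^'n) \<Rightarrow> bool" where
  "formal_inverse X \<longleftrightarrow>
    (\<forall>k n. (\<Sum>l\<le>k + r. B k l ** X l n) = (if k = n then mat 1 else 0)) \<and>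
    (\<forall>k n. (\<Sum>l\<le>n + s. X k l ** B l n) = (if k = n then mat 1 else 0))"

text \<open>
  The next four lemmas describe the general homogeneous solutions: combinations of the \<open>Q\<close> (resp. \<open>Q\<^sup>+\<close>)
  whose coefficients are the initial values.
\<close>

lemma sum_B_Q_sol:
  fixes Z :: "nat \<Rightarrow> complex^'n^'n"
  shows "(\<Sum>l\<le>k + r. B k l ** (\<Sum>i<r. Q_sol r s A lam i (int l) ** Z i)) = 0"
proof -
  have "(\<Sum>l\<le>k + r. B k l ** (\<Sum>i<r. Q_sol r s A lam i (int l) ** Z i)) =
     (\<Sum>i<r. (\<Sum>l\<le>k + r. B k l ** Q_sol r s A lam i (int l)) ** Z i)"
    unfolding matrix_mult_sum_right matrix_mult_sum_left matrix_mul_assoc by (rule sum.swap)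
  then show ?thesis by (simp add: Q_sol_recurrence)
qed

lemma sum_Q_sol_init:
  fixes Z :: "nat \<Rightarrow> complex^'n^'n"
  assumes i: "i < r"
  shows "(\<Sum>i'<r. Q_sol r s A lam i' (int i) ** Z i') = Z i"
proof -
  have "(\<Sum>i'<r. Q_sol r s A lam i' (int i) ** Z i') = (\<Sum>i'<r. if i = i' then Z i' else 0)"
    using i by (intro sum.cong) (auto simp: Q_sol_init)
  then show ?thesis using i by simp
qed

lemma sum_Qp_sol_B:
  fixes Z :: "nat \<Rightarrow> complex^'n^'n"
  shows "(\<Sum>l\<le>k + s. (\<Sum>j<s. Z j ** Qp_sol r s A lam j (int l)) ** B l k) = 0"
proof -
  have "(\<Sum>l\<le>k + s. (\<Sum>j<s. Z j ** Qp_sol r s A lam j (int l)) ** B l k) =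
     (\<Sum>j<s. Z j ** (\<Sum>l\<le>k + s. Qp_sol r s A lam j (int l) ** B l k))"
    unfolding matrix_mult_sum_right matrix_mult_sum_left matrix_mul_assoc by (rule sum.swap)
  then show ?thesis by (simp add: Qp_sol_recurrence)
qed

lemma sum_Qp_sol_init:
  fixes Z :: "nat \<Rightarrow> complex^'n^'n"
  assumes j: "j < s"
  shows "(\<Sum>j'<s. Z j' ** Qp_sol r s A lam j' (int j)) = Z j"
proof -
  have "(\<Sum>j'<s. Z j' ** Qp_sol r s A lam j' (int j)) = (\<Sum>j'<s. if j = j' then Z j' else 0)"
    using j by (intro sum.cong) (auto simp: Qp_sol_init)
  then show ?thesis using j by simp
qed

lemma R_row_recurrence:
  "j < s \<Longrightarrow> (\<Sum>l\<le>k + r. B k l ** R_row r s A lam M l j) = (if k = j then mat 1 else 0)"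
  by (simp add: R_row_def matrix_mult_diff_right sum_subtractf sum_B_Q_sol P_sol_recurrence)

lemma R_row_init: "i < r \<Longrightarrow> j < s \<Longrightarrow> R_row r s A lam M i j = M i j"
  by (simp add: R_row_def sum_Q_sol_init P_sol_init)

lemma Rp_col_recurrence:
  "i < r \<Longrightarrow> (\<Sum>l\<le>k + s. Rp_col r s A lam M l i ** B l k) = (if k = i then mat 1 else 0)"
  by (simp add: Rp_col_def matrix_mult_diff_left sum_subtractf sum_Qp_sol_B Pp_sol_recurrence)

lemma Rp_col_init: "i < r \<Longrightarrow> j < s \<Longrightarrow> Rp_col r s A lam M j i = M i j"
  by (simp add: Rp_col_def sum_Qp_sol_init Pp_sol_init)

text \<open>
  The first \<open>r\<close> rows and the first \<open>s\<close> columns of \<open>X\<close> solve the same inhomogeneous equations as \<open>R\<^sup>+\<close> and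
  \<open>R\<close>, with initial values given by the corner. Off the diagonal the equations are homogeneous: column
  \<open>n\<close> propagates by the \<open>Q\<close> up to the index \<open>n + r - 1\<close>, and row \<open>k\<close> by the \<open>Q\<^sup>+\<close> up to \<open>k + s - 1\<close>. These two
  regions are those of the two formulas for \<open>R\<^bsub>k,n\<^esub>\<close>, and together they cover all positions.
\<close>

lemma formal_inverse_eq_R_entry:
  assumes X: "formal_inverse X" and M: "\<And>i j. i < r \<Longrightarrow> j < s \<Longrightarrow> X i j = M i j"
  shows "X k n = R_entry r s A lam M k n"
proof -
  have right: "(\<Sum>l\<le>k + r. B k l ** X l n) = (if k = n then mat 1 else 0)"
    and left: "(\<Sum>l\<le>n + s. X k l ** B l n) = (if k = n then mat 1 else 0)" for k n
    using X by (auto simp: formal_inverse_def)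
  show ?thesis
  proof (cases "k < n + r")
    case True
    have "X i n = Rp_col r s A lam M n i" if "i < r" for i
      by (rule left_recurrence_unique[where n = "Suc n"])
        (auto simp: left Rp_col_recurrence Rp_col_init M that)
    moreover have "X k n = (\<Sum>i<r. Q_sol r s A lam i (int k) ** X i n)"
      by (rule recurrence_unique[where n = n and Y = "\<lambda>k. X k n" and
          Y' = "\<lambda>k. \<Sum>i<r. Q_sol r s A lam i (int k) ** X i n"])
        (use True in \<open>auto simp: right sum_B_Q_sol sum_Q_sol_init\<close>)
    ultimately show ?thesis using True by (simp add: R_entry_def)
  next
    case False
    have "X k j = R_row r s A lam M k j" if "j < s" for j
      by (rule recurrence_unique[where n = "Suc k"])
        (auto simp: right R_row_recurrence R_row_init M that)
    moreover have "X k n = (\<Sum>j<s. X k j ** Qp_sol r s A lam j (int n))"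
      by (rule left_recurrence_unique[where n = k and Y = "X k" and
          Y' = "\<lambda>n. \<Sum>j<s. X k j ** Qp_sol r s A lam j (int n)"])
        (use False s_pos in \<open>auto simp: left sum_Qp_sol_B sum_Qp_sol_init\<close>)
    ultimately show ?thesis using False by (simp add: R_entry_def)
  qed
qed

text \<open>
  Constructing \<open>X\<close> by columns gives \<open>B X = I\<close> for any choice of the first \<open>r\<close> rows. With the rows \<open>R\<^sup>+\<close>,
  which satisfy \<open>R\<^sup>+ B = I\<close> row by row, \<open>X B\<close> and \<open>I\<close> have the same first \<open>r\<close> rows, and
  \<open>B (X B) = (B X) B = B = B I\<close> forces \<open>X B = I\<close>.
\<close>

lemma formal_inverse_exists:
  "\<exists>X. formal_inverse X \<and> (\<forall>i<r. \<forall>j<s. X i j = M i j)"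
proof -
  have "\<forall>n. \<exists>Y. (\<forall>i<r. Y i = Rp_col r s A lam M n i) \<and>
     (\<forall>k. (\<Sum>l\<le>k + r. B k l ** Y l) = (if k = n then mat 1 else 0))"
    using recurrence_exists by auto
  then obtain X' where X': "\<And>n. (\<forall>i<r. X' n i = Rp_col r s A lam M n i) \<and>
     (\<forall>k. (\<Sum>l\<le>k + r. B k l ** X' n l) = (if k = n then mat 1 else 0))"
    by metis
  define X where "X k n = X' n k" for k n
  have init: "X i n = Rp_col r s A lam M n i" if "i < r" for i n
    using X' that by (simp add: X_def)
  have right: "(\<Sum>l\<le>k + r. B k l ** X l n) = (if k = n then mat 1 else 0)" for k n
    using X' by (simp add: X_def)
  have left: "(\<Sum>m\<le>n + s. X k m ** B m n) = (if k = n then mat 1 else 0)" for k n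
  proof (rule recurrence_unique[where n = "Suc k" and k = k and
        Y = "\<lambda>l. \<Sum>m\<le>n + s. X l m ** B m n" and Y' = "\<lambda>l. if l = n then mat 1 else 0"])
    fix k'
    have "(\<Sum>l\<le>k' + r. B k' l ** (\<Sum>m\<le>n + s. X l m ** B m n)) =
       (\<Sum>m\<le>n + s. (\<Sum>l\<le>k' + r. B k' l ** X l m) ** B m n)"
      unfolding matrix_mult_sum_right matrix_mult_sum_left matrix_mul_assoc by (rule sum.swap)
    also have "\<dots> = (\<Sum>m\<le>n + s. if k' = m then B m n else 0)"
      by (intro sum.cong) (auto simp: right)
    also have "\<dots> = B k' n" by (auto simp: B_zero)
    also have "\<dots> = (\<Sum>l\<le>k' + r. if n = l then B k' l else 0)" by (auto simp: B_zero)
    also have "\<dots> = (\<Sum>l\<le>k' + r. B k' l ** (if l = n then mat 1 else 0))"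
      by (intro sum.cong) auto
    finally show "(\<Sum>l\<le>k' + r. B k' l ** (\<Sum>m\<le>n + s. X l m ** B m n)) =
       (\<Sum>l\<le>k' + r. B k' l ** (if l = n then mat 1 else 0))" .
  next
    fix i assume "i < r"
    then show "(\<Sum>m\<le>n + s. X i m ** B m n) = (if i = n then mat 1 else 0)"
      by (auto simp: init Rp_col_recurrence)
  qed simp
  have "formal_inverse X" by (simp add: formal_inverse_def right left)
  then show ?thesis using init Rp_col_init by auto
qed

text \<open>
  Obtained by identifying the inverse constructed above, which avoids verifying directly that the two
  formulas for \<open>R\<^bsub>k,n\<^esub>\<close> agree on their common region.
\<close>

lemma formal_inverse_R_entry: "formal_inverse (R_entry r s A lam M)"
  and R_entry_corner: "i < r \<Longrightarrow> j < s \<Longrightarrow> R_entry r s A lam M i j = M i j"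
proof -
  obtain X where X: "formal_inverse X" "\<forall>i<r. \<forall>j<s. X i j = M i j"
    using formal_inverse_exists by blast
  then have "X = R_entry r s A lam M"
    by (intro ext formal_inverse_eq_R_entry) auto
  with X show "formal_inverse (R_entry r s A lam M)"
    "i < r \<Longrightarrow> j < s \<Longrightarrow> R_entry r s A lam M i j = M i j" by auto
qed

end

section \<open>Norms of matrices\<close>

lemma norm_vec_le_sum: "norm x \<le> (\<Sum>i\<in>UNIV. norm (x $ i))"
  by (simp add: norm_vec_def L2_set_le_sum)

lemma norm_matrix_vector_mult_le:
  "norm (X *v v) \<le> (real CARD('n))\<^sup>2 * norm X * norm v" for X :: "complex^'n^'n"
proof -
  have "norm ((X *v v) $ i) \<le> real CARD('n) * (norm X * norm v)" for i
  proof -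
    have "norm ((X *v v) $ i) \<le> (\<Sum>j\<in>UNIV. norm (X $ i $ j * v $ j))"
      unfolding matrix_vector_mult_def by (simp add: norm_sum)
    also have "\<dots> \<le> (\<Sum>j\<in>(UNIV :: 'n set). norm X * norm v)"
      unfolding norm_mult
      by (intro sum_mono mult_mono Finite_Cartesian_Product.norm_nth_le order_trans[OF Finite_Cartesian_Product.norm_nth_le Finite_Cartesian_Product.norm_nth_le]) auto
    finally show ?thesis by simp
  qed
  then have "norm (X *v v) \<le> (\<Sum>i\<in>(UNIV :: 'n set). real CARD('n) * (norm X * norm v))"
    by (intro order_trans[OF norm_vec_le_sum] sum_mono)
  then show ?thesis by (simp add: power2_eq_square mult_ac)
qed

lemma matrix_vector_mult_axis: "(X *v axis b 1) $ a = X $ a $ b" for X :: "complex^'n^'n"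
  by (simp add: matrix_vector_mult_def axis_def if_distrib[of "\<lambda>x. _ * x"] cong: if_cong)

lemma norm_matrix_le_of_columns:
  fixes X :: "complex^'n^'n"
  assumes "\<And>b. norm (X *v axis b 1) \<le> c"
  shows "norm X \<le> (real CARD('n))\<^sup>2 * c"
proof -
  have entry: "norm (X $ a $ b) \<le> c" for a b
  proof -
    have "X $ a $ b = (X *v axis b 1) $ a"
      by (simp add: matrix_vector_mult_axis)
    then show ?thesis using assms[of b] Finite_Cartesian_Product.norm_nth_le[of "X *v axis b 1" a] by (metis order_trans)
  qed
  have "norm X \<le> (\<Sum>a\<in>UNIV. \<Sum>b\<in>UNIV. norm (X $ a $ b))"
    by (intro order_trans[OF norm_vec_le_sum] sum_mono norm_vec_le_sum)
  also have "\<dots> \<le> (\<Sum>a\<in>(UNIV :: 'n set). \<Sum>b\<in>(UNIV :: 'n set). c)"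
    by (intro sum_mono entry)
  finally show ?thesis by (simp add: power2_eq_square mult_ac)
qed

lemma mat_of_real_mult: "mat (complex_of_real c) ** X = c *\<^sub>R X" for X :: "complex^'n^'n"
  by (simp add: vec_eq_iff mat_mult_nth scaleR_conv_of_real[where 'a = complex])

lemma norm_mat_of_real_mult: "norm (mat (complex_of_real c) ** X) = \<bar>c\<bar> * norm X" for X :: "complex^'n^'n"
  by (simp add: mat_of_real_mult)

text \<open>
  All norms on a finite-dimensional space are equivalent: \<open>\<nu>\<close> is bounded by its values on the matrix units,
  hence it is Lipschitz continuous and attains a positive minimum on the compact unit sphere.
\<close>

lemma matrix_norm_equivalent:
  fixes \<nu> :: "complex^'n^'n \<Rightarrow> real"
  assumes "is_matrix_norm \<nu>"
  shows "\<exists>c>0. \<forall>X. \<nu> X \<le> c * norm X \<and> norm X \<le> c * \<nu> X"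
proof -
  have nonneg: "0 \<le> \<nu> X" and zero: "\<nu> X = 0 \<longleftrightarrow> X = 0"
    and scale: "\<nu> (mat c ** X) = cmod c * \<nu> X" and triangle: "\<nu> (X + Y) \<le> \<nu> X + \<nu> Y" for X Y c
    using assms by (auto simp: is_matrix_norm_def)
  have sum_le: "\<nu> (\<Sum>i\<in>I. f i) \<le> (\<Sum>i\<in>I. \<nu> (f i))" for I :: "'n set" and f
    by (induction I rule: infinite_finite_induct) (auto simp: zero[of 0, simplified] intro: order_trans[OF triangle])
  define U :: "'n \<Rightarrow> 'n \<Rightarrow> complex^'n^'n" where "U a b = (\<chi> i j. if i = a \<and> j = b then 1 else 0)" for a b
  define c1 where "c1 = (\<Sum>a\<in>UNIV. \<Sum>b\<in>UNIV. \<nu> (U a b))"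
  have upper: "\<nu> X \<le> c1 * norm X" for X
  proof -
    have "X = (\<Sum>a\<in>UNIV. \<Sum>b\<in>UNIV. mat (X $ a $ b) ** U a b)"
    proof -
      have "(\<Sum>a\<in>UNIV. \<Sum>b\<in>UNIV. X $ a $ b * U a b $ i $ j) =
          (\<Sum>a\<in>UNIV. \<Sum>b\<in>UNIV. if i = a then (if j = b then X $ a $ b else 0) else 0)" for i j
        by (intro sum.cong) (auto simp: U_def)
      also have "\<dots> i j = X $ i $ j" for i j
        by (simp add: if_distrib[of "sum _"] sum.If_cases)
      finally show ?thesis by (simp add: vec_eq_iff mat_mult_nth)
    qed
    then have "\<nu> X \<le> (\<Sum>a\<in>UNIV. \<nu> (\<Sum>b\<in>UNIV. mat (X $ a $ b) ** U a b))"
      using sum_le[of "\<lambda>a. \<Sum>b\<in>UNIV. mat (X $ a $ b) ** U a b" UNIV] by simp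
    also have "\<dots> \<le> (\<Sum>a\<in>UNIV. \<Sum>b\<in>UNIV. \<nu> (mat (X $ a $ b) ** U a b))"
      by (intro sum_mono sum_le)
    also have "\<dots> \<le> (\<Sum>a\<in>UNIV. \<Sum>b\<in>UNIV. norm X * \<nu> (U a b))"
      unfolding scale
      by (intro sum_mono mult_right_mono nonneg order_trans[OF Finite_Cartesian_Product.norm_nth_le Finite_Cartesian_Product.norm_nth_le])
    finally show ?thesis by (simp add: c1_def sum_distrib_left mult.commute)
  qed
  have c1: "0 \<le> c1" by (auto simp: c1_def intro!: sum_nonneg nonneg)
  have lipschitz: "\<bar>\<nu> X - \<nu> Y\<bar> \<le> c1 * dist X Y" for X Y
  proof -
    have "\<nu> (Y - X) = \<nu> (X - Y)"
      using scale[of "-1" "X - Y"] mat_of_real_mult[of "-1" "X - Y"] by simp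
    moreover have "\<nu> X \<le> \<nu> (X - Y) + \<nu> Y" "\<nu> Y \<le> \<nu> (Y - X) + \<nu> X"
      using triangle[of "X - Y" Y] triangle[of "Y - X" X] by simp_all
    moreover have "\<nu> (X - Y) \<le> c1 * dist X Y" using upper[of "X - Y"] by (simp add: dist_norm)
    ultimately show ?thesis by linarith
  qed
  have "continuous_on (sphere 0 1) \<nu>"
  proof -
    have "c1-lipschitz_on (sphere 0 1) \<nu>"
      using lipschitz c1 by (auto simp: lipschitz_on_def dist_real_def)
    then show ?thesis by (rule lipschitz_on_continuous_on)
  qed
  moreover have "sphere (0 :: complex^'n^'n) 1 \<noteq> {}" by simp
  ultimately obtain X0 where X0: "X0 \<in> sphere 0 1" "\<And>X. X \<in> sphere 0 1 \<Longrightarrow> \<nu> X0 \<le> \<nu> X"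
    using continuous_attains_inf[of "sphere 0 1" \<nu>] by auto
  have pos: "0 < \<nu> X0"
    using nonneg[of X0] zero[of X0] X0(1) by (cases "\<nu> X0 = 0") auto
  have lower: "norm X \<le> 1 / \<nu> X0 * \<nu> X" for X
  proof (cases "X = 0")
    case False
    have "\<nu> X0 \<le> \<nu> ((1 / norm X) *\<^sub>R X)" using False by (intro X0(2)) simp
    also have "\<dots> = \<nu> X / norm X"
      using scale[of "of_real (1 / norm X)" X] unfolding mat_of_real_mult by (simp add: norm_divide)
    finally show ?thesis using False pos by (simp add: field_simps)
  qed (use pos nonneg in simp)
  have "\<nu> X \<le> (c1 + 1 / \<nu> X0) * norm X" "norm X \<le> (c1 + 1 / \<nu> X0) * \<nu> X" for X
    using upper[of X] lower[of X] c1 pos nonneg[of X]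
    by (auto simp: distrib_right intro: add_increasing add_increasing2)
  moreover have "0 < c1 + 1 / \<nu> X0" using c1 pos by (simp add: add_nonneg_pos)
  ultimately show ?thesis by blast
qed

section \<open>Bounded operators on the sequence space\<close>

abbreviation single :: "nat \<Rightarrow> complex^'n \<Rightarrow> nat \<Rightarrow> complex^'n" where
  "single n v \<equiv> (\<lambda>m. if m = n then v else 0)"

lemma l2_norm_power2:
  "u \<in> l2_space \<Longrightarrow> (l2_norm u)\<^sup>2 = (\<Sum>j. (norm (u j))\<^sup>2)"
  by (simp add: l2_norm_def l2_space_def suminf_nonneg)

lemma l2_norm_nonneg: "u \<in> l2_space \<Longrightarrow> 0 \<le> l2_norm u"
  by (simp add: l2_norm_def l2_space_def suminf_nonneg)

lemma sum_le_l2_norm: "u \<in> l2_space \<Longrightarrow> (\<Sum>j<L. (norm (u j))\<^sup>2) \<le> (l2_norm u)\<^sup>2"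
  unfolding l2_norm_power2 by (rule sum_le_suminf) (auto simp: l2_space_def)

lemma norm_le_l2_norm:
  assumes "u \<in> l2_space" shows "norm (u k) \<le> l2_norm u"
proof -
  have "(norm (u k))\<^sup>2 \<le> (\<Sum>j<Suc k. (norm (u j))\<^sup>2)"
    by (rule member_le_sum) auto
  also have "\<dots> \<le> (l2_norm u)\<^sup>2" by (rule sum_le_l2_norm[OF assms])
  finally show ?thesis using l2_norm_nonneg[OF assms] by (rule power2_le_imp_le)
qed

lemma l2_boundedI:
  assumes "\<And>K. (\<Sum>k<K. (norm (u k))\<^sup>2) \<le> c\<^sup>2" and "0 \<le> c"
  shows "u \<in> l2_space" and "l2_norm u \<le> c"
proof -
  have sm: "summable (\<lambda>k. (norm (u k))\<^sup>2)"
    by (rule summableI_nonneg_bounded[where x = "c\<^sup>2"]) (use assms in auto)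
  then show u: "u \<in> l2_space" by (simp add: l2_space_def)
  have "(l2_norm u)\<^sup>2 \<le> c\<^sup>2"
    unfolding l2_norm_power2[OF u] by (rule suminf_le_const[OF sm assms(1)])
  then show "l2_norm u \<le> c" using assms(2) by (rule power2_le_imp_le)
qed

lemma single_l2: "single n v \<in> l2_space" and l2_norm_single: "l2_norm (single n v) = norm v"
proof -
  have "(\<lambda>j. (norm (single n v j))\<^sup>2) sums (norm v)\<^sup>2"
    using sums_single[of n "\<lambda>_. (norm v)\<^sup>2"] by (simp add: if_distrib[of norm] if_distrib[of "\<lambda>x. x\<^sup>2"] cong: if_cong)
  then show "single n v \<in> l2_space" "l2_norm (single n v) = norm v"
    by (auto simp: l2_space_def l2_norm_def sums_iff)
qed

text \<open>The weak form of the triangle inequality in the second claim suffices for the estimates below.\<close>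

lemma l2_add:
  assumes u: "u \<in> l2_space" and v: "v \<in> l2_space"
  shows "(\<lambda>k. u k + v k) \<in> l2_space"
    and "(l2_norm (\<lambda>k. u k + v k))\<^sup>2 \<le> 2 * (l2_norm u)\<^sup>2 + 2 * (l2_norm v)\<^sup>2"
proof -
  define c where "c = sqrt (2 * (l2_norm u)\<^sup>2 + 2 * (l2_norm v)\<^sup>2)"
  have c: "c\<^sup>2 = 2 * (l2_norm u)\<^sup>2 + 2 * (l2_norm v)\<^sup>2" "0 \<le> c" by (simp_all add: c_def)
  have pt: "(norm (x + y))\<^sup>2 \<le> 2 * (norm x)\<^sup>2 + 2 * (norm y)\<^sup>2" for x y :: "complex^'n"
  proof -
    have "(norm (x + y))\<^sup>2 \<le> (norm x + norm y)\<^sup>2" by (intro power_mono norm_triangle_ineq) auto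
    moreover have "0 \<le> (norm x - norm y)\<^sup>2" by simp
    ultimately show ?thesis by (simp add: power2_sum power2_diff)
  qed
  have bd: "(\<Sum>k<K. (norm (u k + v k))\<^sup>2) \<le> c\<^sup>2" for K
  proof -
    have "(\<Sum>k<K. (norm (u k + v k))\<^sup>2) \<le> (\<Sum>k<K. 2 * (norm (u k))\<^sup>2 + 2 * (norm (v k))\<^sup>2)"
      by (intro sum_mono pt)
    also have "\<dots> \<le> c\<^sup>2"
      using sum_le_l2_norm[OF u, of K] sum_le_l2_norm[OF v, of K]
      by (simp add: c sum.distrib sum_distrib_left[symmetric])
    finally show ?thesis .
  qed
  show "(\<lambda>k. u k + v k) \<in> l2_space" by (rule l2_boundedI(1)[OF bd c(2)])
  have "l2_norm (\<lambda>k. u k + v k) \<le> c" by (rule l2_boundedI(2)[OF bd c(2)])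
  then have "(l2_norm (\<lambda>k. u k + v k))\<^sup>2 \<le> c\<^sup>2"
    by (intro power_mono l2_norm_nonneg[OF l2_boundedI(1)[OF bd c(2)]])
  then show "(l2_norm (\<lambda>k. u k + v k))\<^sup>2 \<le> 2 * (l2_norm u)\<^sup>2 + 2 * (l2_norm v)\<^sup>2" by (simp add: c)
qed

lemma l2_weighted:
  assumes "u \<in> l2_space" and "\<And>k. norm (v k) \<le> c * norm (u k)"
  shows "v \<in> l2_space"
proof -
  have "summable (\<lambda>k. c\<^sup>2 * (norm (u k))\<^sup>2)"
    using assms(1) by (simp add: l2_space_def)
  then have "summable (\<lambda>k. (norm (v k))\<^sup>2)"
  proof (rule summable_comparison_test'[where N = 0])
    show "norm ((norm (v n))\<^sup>2) \<le> c\<^sup>2 * (norm (u n))\<^sup>2" for n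
      using power_mono[OF assms(2)[of n], of 2] by (simp add: power_mult_distrib)
  qed
  then show ?thesis by (simp add: l2_space_def)
qed

lemma geometric_sum_le:
  fixes q :: real
  assumes "0 < q" "q < 1" "finite F"
  shows "(\<Sum>m\<in>F. q ^ m) \<le> 1 / (1 - q)"
  using assms sum_le_suminf[of "\<lambda>m. q ^ m" F] by (simp add: suminf_geometric summable_geometric)

lemma kernel_row_sum:
  fixes q :: real
  assumes q: "0 < q" "q < 1"
  shows "(\<Sum>l<L. q ^ nat \<bar>int k - int l\<bar>) \<le> 2 / (1 - q)"
proof -
  have part: "(\<Sum>l\<in>S. q ^ nat \<bar>int k - int l\<bar>) \<le> 1 / (1 - q)"
    if "finite S" "inj_on (\<lambda>l. nat \<bar>int k - int l\<bar>) S" for S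
    using geometric_sum_le[OF q, of "(\<lambda>l. nat \<bar>int k - int l\<bar>) ` S"] that
    by (simp add: sum.reindex)
  have "(\<Sum>l<L. q ^ nat \<bar>int k - int l\<bar>) =
     (\<Sum>l\<in>{..<L} \<inter> {..k}. q ^ nat \<bar>int k - int l\<bar>) + (\<Sum>l\<in>{..<L} \<inter> {k<..}. q ^ nat \<bar>int k - int l\<bar>)"
    by (subst sum.union_disjoint[symmetric]) (auto intro!: sum.cong)
  also have "\<dots> \<le> 1 / (1 - q) + 1 / (1 - q)"
    by (intro add_mono part) (auto simp: inj_on_def)
  finally show ?thesis by simp
qed

text \<open>
  The Schur test: splitting the kernel \<open>g\<close> as \<open>sqrt g * sqrt g\<close> in the Cauchy-Schwarz inequality bounds the
  square of each component by a row sum times \<open>\<Sum>l. g k l * (b l)\<^sup>2\<close>; summing over \<open>k\<close> produces column sums.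
  The bound does not depend on the truncation, so it passes to the infinite matrix.
\<close>

lemma schur_test_finite:
  fixes q :: real and b :: "nat \<Rightarrow> real"
  assumes q: "0 < q" "q < 1"
  shows "(\<Sum>k<K. (\<Sum>l<L. q ^ nat \<bar>int k - int l\<bar> * b l)\<^sup>2) \<le> (2 / (1 - q))\<^sup>2 * (\<Sum>l<L. (b l)\<^sup>2)"
proof -
  define g where "g k l = q ^ nat \<bar>int k - int l\<bar>" for k l
  define S where "S = 2 / (1 - q)"
  have g: "0 \<le> g k l" "g k l = g l k" for k l
    using q by (auto simp: g_def abs_minus_commute)
  have row: "(\<Sum>l<L. g k l) \<le> S" for L k using kernel_row_sum[OF q] by (simp add: g_def S_def)
  have S: "0 \<le> S" using q by (simp add: S_def)
  have "(\<Sum>l<L. g k l * b l)\<^sup>2 \<le> S * (\<Sum>l<L. g k l * (b l)\<^sup>2)" for k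
  proof -
    have "(\<Sum>l<L. g k l * b l)\<^sup>2 = (\<Sum>l<L. sqrt (g k l) * (sqrt (g k l) * b l))\<^sup>2"
      by (simp add: mult.assoc[symmetric] g)
    also have "\<dots> \<le> (\<Sum>l<L. (sqrt (g k l))\<^sup>2) * (\<Sum>l<L. (sqrt (g k l) * b l)\<^sup>2)"
      by (rule Cauchy_Schwarz_ineq_sum)
    also have "\<dots> = (\<Sum>l<L. g k l) * (\<Sum>l<L. g k l * (b l)\<^sup>2)"
      by (simp add: power_mult_distrib g)
    also have "\<dots> \<le> S * (\<Sum>l<L. g k l * (b l)\<^sup>2)"
      by (intro mult_right_mono row sum_nonneg mult_nonneg_nonneg g) auto
    finally show ?thesis .
  qed
  then have "(\<Sum>k<K. (\<Sum>l<L. g k l * b l)\<^sup>2) \<le> (\<Sum>k<K. S * (\<Sum>l<L. g k l * (b l)\<^sup>2))"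
    by (rule sum_mono)
  also have "\<dots> = S * (\<Sum>l<L. (\<Sum>k<K. g l k) * (b l)\<^sup>2)"
    by (simp add: sum_distrib_left sum_distrib_right sum.swap[of _ "{..<K}"] g(2))
  also have "\<dots> \<le> S * (\<Sum>l<L. S * (b l)\<^sup>2)"
    by (intro mult_left_mono sum_mono mult_right_mono row S) auto
  also have "\<dots> = S\<^sup>2 * (\<Sum>l<L. (b l)\<^sup>2)"
    by (simp add: power2_eq_square sum_distrib_left[symmetric])
  finally show ?thesis by (simp add: g_def S_def)
qed

text \<open>
  The decay is stated for the action of the blocks on vectors, because this is what operators on \<open>l\<^sup>2\<close> see;
  \<open>exp_decay_iff\<close> below relates it to the norm \<open>\<nu>\<close>.
\<close>

definition decays :: "real \<Rightarrow> real \<Rightarrow> (nat \<Rightarrow> nat \<Rightarrow> complex^'n^'n) \<Rightarrow> bool" where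
  "decays c q W \<longleftrightarrow> 0 \<le> c \<and> 0 < q \<and> q < 1 \<and>
     (\<forall>k l v. norm (W k l *v v) \<le> c * q ^ nat \<bar>int k - int l\<bar> * norm v)"

lemma decays_matrix_op:
  fixes W :: "nat \<Rightarrow> nat \<Rightarrow> complex^'n^'n"
  assumes W: "decays c q W" and u: "u \<in> l2_space"
  shows "summable (\<lambda>l. W k l *v u l)" and "matrix_op W u \<in> l2_space"
    and "l2_norm (matrix_op W u) \<le> c * (2 / (1 - q)) * l2_norm u"
proof -
  have c: "0 \<le> c" and q: "0 < q" "q < 1"
    and W: "norm (W k l *v v) \<le> c * q ^ nat \<bar>int k - int l\<bar> * norm v" for k l v
    using W by (auto simp: decays_def)
  define g where "g k l = q ^ nat \<bar>int k - int l\<bar> * norm (u l)" for k l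
  have g0: "0 \<le> g k l" for k l using q by (simp add: g_def)
  define D where "D = 2 / (1 - q) * l2_norm u"
  have D: "0 \<le> D" using q l2_norm_nonneg[OF u] by (simp add: D_def)
  have fin: "(\<Sum>k<K. (\<Sum>l<L. g k l)\<^sup>2) \<le> D\<^sup>2" for K L
  proof -
    have "(\<Sum>k<K. (\<Sum>l<L. g k l)\<^sup>2) \<le> (2 / (1 - q))\<^sup>2 * (\<Sum>l<L. (norm (u l))\<^sup>2)"
      unfolding g_def by (rule schur_test_finite[OF q])
    also have "\<dots> \<le> (2 / (1 - q))\<^sup>2 * (l2_norm u)\<^sup>2"
      by (intro mult_left_mono sum_le_l2_norm[OF u]) auto
    finally show ?thesis by (simp add: D_def power_mult_distrib power_divide)
  qed
  have sg: "summable (g k)" for k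
  proof (rule summableI_nonneg_bounded[where x = D])
    fix L
    have "(\<Sum>l<L. g k l)\<^sup>2 \<le> (\<Sum>k<Suc k. (\<Sum>l<L. g k l)\<^sup>2)"
      by (rule member_le_sum) auto
    also have "\<dots> \<le> D\<^sup>2" by (rule fin)
    finally show "(\<Sum>l<L. g k l) \<le> D" using D by (rule power2_le_imp_le)
  qed (rule g0)
  have dom: "norm (W k l *v u l) \<le> c * g k l" for k l
    using W[of k l "u l"] by (simp add: g_def mult.assoc)
  have sW: "summable (\<lambda>l. norm (W k l *v u l))" for k
    by (rule summable_comparison_test'[where N = 0, OF summable_mult[OF sg[of k], of c]]) (simp add: dom)
  show "summable (\<lambda>l. W k l *v u l)" by (rule summable_norm_cancel[OF sW])
  have le: "norm (matrix_op W u k) \<le> c * (\<Sum>l. g k l)" for k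
  proof -
    have "norm (matrix_op W u k) \<le> (\<Sum>l. norm (W k l *v u l))"
      unfolding matrix_op_def by (rule summable_norm[OF sW])
    also have "\<dots> \<le> (\<Sum>l. c * g k l)"
      by (rule suminf_le[OF dom sW summable_mult[OF sg]])
    finally show ?thesis by (simp add: suminf_mult[OF sg])
  qed
  have "(\<Sum>k<K. (norm (matrix_op W u k))\<^sup>2) \<le> (c * D)\<^sup>2" for K
  proof -
    have "(\<lambda>L. \<Sum>k<K. (\<Sum>l<L. g k l)\<^sup>2) \<longlonglongrightarrow> (\<Sum>k<K. (\<Sum>l. g k l)\<^sup>2)"
      by (intro tendsto_sum tendsto_power summable_LIMSEQ sg)
    then have lim: "(\<Sum>k<K. (\<Sum>l. g k l)\<^sup>2) \<le> D\<^sup>2"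
      by (rule LIMSEQ_le_const2) (use fin in blast)
    have "(\<Sum>k<K. (norm (matrix_op W u k))\<^sup>2) \<le> (\<Sum>k<K. (c * (\<Sum>l. g k l))\<^sup>2)"
      by (intro sum_mono power_mono le) auto
    also have "\<dots> = c\<^sup>2 * (\<Sum>k<K. (\<Sum>l. g k l)\<^sup>2)"
      by (simp add: power_mult_distrib sum_distrib_left)
    also have "\<dots> \<le> c\<^sup>2 * D\<^sup>2" by (intro mult_left_mono lim) auto
    finally show ?thesis by (simp add: power_mult_distrib)
  qed
  note bd = l2_boundedI[OF this mult_nonneg_nonneg[OF c D]]
  show "matrix_op W u \<in> l2_space" by (rule bd)
  show "l2_norm (matrix_op W u) \<le> c * (2 / (1 - q)) * l2_norm u"
    using bd(2) by (simp add: D_def mult.assoc)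
qed

lemma decays_bounded_l2_operator:
  assumes W: "decays c q W" shows "bounded_l2_operator (matrix_op W)"
proof -
  have "matrix_op W (\<lambda>j. a *s u j + v j) k = a *s matrix_op W u k + matrix_op W v k"
    if u: "u \<in> l2_space" and v: "v \<in> l2_space" for u v a k
  proof -
    have *: "bounded_linear ((*s) a :: complex^'n \<Rightarrow> complex^'n)"
    proof -
      have "(*s) a = (*v) (mat a :: complex^'n^'n)"
        by (intro ext) (simp add: vec_eq_iff matrix_vector_mult_def mat_def if_distrib[of "\<lambda>x. x * _"] cong: if_cong)
      then show ?thesis by (metis matrix_vector_mul_bounded_linear)
    qed
    have "(\<lambda>l. a *s (W k l *v u l) + W k l *v v l) sums (a *s matrix_op W u k + matrix_op W v k)"
      unfolding matrix_op_def
      by (intro sums_add bounded_linear.sums[OF *] summable_sums decays_matrix_op(1)[OF W] u v)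
    then show ?thesis
      by (simp add: matrix_op_def matrix_vector_right_distrib vector_scalar_commute sums_iff)
  qed
  then show ?thesis
    unfolding bounded_l2_operator_def using decays_matrix_op(2,3)[OF W] by blast
qed

text \<open>
  Treating a bounded band matrix as exponentially decaying reduces its boundedness to the Schur test.
  The norm bound remains proportional to \<open>c\<close>, which the Combes-Thomas estimate exploits.
\<close>

lemma banded_decays:
  fixes W :: "nat \<Rightarrow> nat \<Rightarrow> complex^'n^'n"
  assumes W: "\<And>k l. norm (W k l) \<le> c" and 0: "\<And>k l. l + d < k \<or> k + d < l \<Longrightarrow> W k l = 0"
  shows "decays ((real CARD('n))\<^sup>2 * c * 2 ^ d) (1 / 2) W"
proof -
  have c: "0 \<le> c" using W[of 0 0] norm_ge_zero order_trans by blast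
  have "norm (W k l *v v) \<le> (real CARD('n))\<^sup>2 * c * 2 ^ d * (1 / 2) ^ nat \<bar>int k - int l\<bar> * norm v" for k l v
  proof (cases "l + d < k \<or> k + d < l")
    case False
    then have "(1 / 2 :: real) ^ d \<le> (1 / 2) ^ nat \<bar>int k - int l\<bar>"
      by (intro power_decreasing) auto
    then have *: "1 \<le> 2 ^ d * (1 / 2 :: real) ^ nat \<bar>int k - int l\<bar>"
      by (simp add: field_simps)
    have "norm (W k l *v v) \<le> (real CARD('n))\<^sup>2 * norm (W k l) * norm v"
      by (rule norm_matrix_vector_mult_le)
    also have "\<dots> \<le> (real CARD('n))\<^sup>2 * c * norm v"
      by (intro mult_right_mono mult_left_mono W) auto
    also have "\<dots> \<le> (real CARD('n))\<^sup>2 * c * norm v * (2 ^ d * (1 / 2 :: real) ^ nat \<bar>int k - int l\<bar>)"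
      using mult_left_mono[OF *, of "(real CARD('n))\<^sup>2 * c * norm v"] c by simp
    finally show ?thesis by (simp add: mult_ac)
  qed (use c in \<open>simp add: 0\<close>)
  then show ?thesis using c by (simp add: decays_def)
qed

lemma matrix_op_single: "matrix_op W (single n v) k = W k n *v v"
proof -
  have "matrix_op W (single n v) k = (\<Sum>l\<in>{n}. W k l *v single n v l)"
    unfolding matrix_op_def by (rule suminf_finite) auto
  then show ?thesis by simp
qed

lemma bounded_l2_operatorD:
  assumes "bounded_l2_operator T"
  shows "u \<in> l2_space \<Longrightarrow> T u \<in> l2_space"
    and "u \<in> l2_space \<Longrightarrow> v \<in> l2_space \<Longrightarrow> T (\<lambda>j. c *s u j + v j) k = c *s T u k + T v k"
    and "\<exists>K>0. \<forall>u\<in>l2_space. l2_norm (T u) \<le> K * l2_norm u"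
proof -
  show "u \<in> l2_space \<Longrightarrow> T u \<in> l2_space"
    "u \<in> l2_space \<Longrightarrow> v \<in> l2_space \<Longrightarrow> T (\<lambda>j. c *s u j + v j) k = c *s T u k + T v k"
    using assms by (auto simp: bounded_l2_operator_def)
  obtain K where K: "\<forall>u\<in>l2_space. l2_norm (T u) \<le> K * l2_norm u"
    using assms by (auto simp: bounded_l2_operator_def)
  have "l2_norm (T u) \<le> (\<bar>K\<bar> + 1) * l2_norm u" if "u \<in> l2_space" for u
    using K[rule_format, OF that] mult_right_mono[of K "\<bar>K\<bar> + 1" "l2_norm u"] l2_norm_nonneg[OF that]
    by linarith
  then show "\<exists>K>0. \<forall>u\<in>l2_space. l2_norm (T u) \<le> K * l2_norm u"
    by (intro exI[of _ "\<bar>K\<bar> + 1"]) auto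
qed

lemma bounded_l2_operator_compose:
  assumes T: "bounded_l2_operator T" and S: "bounded_l2_operator S"
  shows "bounded_l2_operator (\<lambda>u. T (S u))"
proof -
  obtain K L where K: "0 < K" "\<forall>u\<in>l2_space. l2_norm (T u) \<le> K * l2_norm u"
    and L: "\<forall>u\<in>l2_space. l2_norm (S u) \<le> L * l2_norm u"
    using bounded_l2_operatorD(3)[OF T] bounded_l2_operatorD(3)[OF S] by blast
  have "l2_norm (T (S u)) \<le> (K * L) * l2_norm u" if "u \<in> l2_space" for u
  proof -
    have "l2_norm (T (S u)) \<le> K * l2_norm (S u)"
      using K bounded_l2_operatorD(1)[OF S that] by blast
    also have "\<dots> \<le> K * (L * l2_norm u)" using K L that by (intro mult_left_mono) auto
    finally show ?thesis by (simp add: mult.assoc)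
  qed
  then have bound: "\<exists>K. \<forall>u\<in>l2_space. l2_norm (T (S u)) \<le> K * l2_norm u" by blast
  have "T (S (\<lambda>j. c *s u j + v j)) k = c *s T (S u) k + T (S v) k"
    if "u \<in> l2_space" "v \<in> l2_space" for u v c k
  proof -
    have "S (\<lambda>j. c *s u j + v j) = (\<lambda>k. c *s S u k + S v k)"
      using bounded_l2_operatorD(2)[OF S that] by blast
    then show ?thesis
      using bounded_l2_operatorD(2)[OF T bounded_l2_operatorD(1)[OF S that(1)] bounded_l2_operatorD(1)[OF S that(2)]]
      by (simp only:)
  qed
  then show ?thesis
    unfolding bounded_l2_operator_def
    using bound bounded_l2_operatorD(1)[OF T bounded_l2_operatorD(1)[OF S]] by blast
qed

text \<open>
  Truncations of \<open>u\<close> converge to \<open>u\<close> in \<open>l\<^sup>2\<close>, so a bounded operator is determined by its values on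
  sequences supported at one index. This replaces the interchange of infinite sums in products of operators.
\<close>

lemma bounded_l2_operator_expansion:
  assumes T: "bounded_l2_operator T" and u: "u \<in> l2_space"
  shows "(\<lambda>l. T (single l (u l)) k) sums T u k"
proof -
  define tr where "tr L = (\<lambda>m. if m < L then u m else 0)" for L
  define tl where "tl L = (\<lambda>m. if m < L then 0 else u m)" for L
  have tr_l2: "tr L \<in> l2_space" and tl_l2: "tl L \<in> l2_space" for L
    by (rule l2_weighted[OF u, of _ 1]; simp add: tr_def tl_def)+
  have tr_sum: "T (tr L) k = (\<Sum>l<L. T (single l (u l)) k)" for L
  proof (induction L)
    case 0
    have "T (\<lambda>j. 1 *s tr 0 j + tr 0 j) k = 1 *s T (tr 0) k + T (tr 0) k"
      by (rule bounded_l2_operatorD(2)[OF T tr_l2 tr_l2])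
    then show ?case by (simp add: tr_def)
  next
    case (Suc L)
    have "tr (Suc L) = (\<lambda>j. 1 *s tr L j + single L (u L) j)"
      by (auto simp: tr_def less_Suc_eq)
    then show ?case
      using bounded_l2_operatorD(2)[OF T tr_l2 single_l2, of 1 L L "u L" k] Suc by simp
  qed
  have split: "T u k = T (tr L) k + T (tl L) k" for L
  proof -
    have "u = (\<lambda>j. 1 *s tr L j + tl L j)" by (auto simp: tr_def tl_def)
    then show ?thesis using bounded_l2_operatorD(2)[OF T tr_l2 tl_l2, of 1 L L k] by simp
  qed
  obtain K where K: "0 < K" "\<forall>u\<in>l2_space. l2_norm (T u) \<le> K * l2_norm u"
    using bounded_l2_operatorD(3)[OF T] by blast
  have tail: "(\<lambda>L. l2_norm (tl L)) \<longlonglongrightarrow> 0"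
  proof -
    have sm: "summable (\<lambda>j. (norm (u j))\<^sup>2)" using u by (simp add: l2_space_def)
    have "(\<Sum>j. (norm (tl L j))\<^sup>2) = (\<Sum>j. (norm (u j))\<^sup>2) - (\<Sum>j<L. (norm (u j))\<^sup>2)" for L
    proof -
      have "(\<Sum>j. (norm (tl L j))\<^sup>2) = (\<Sum>j. (norm (tl L (j + L)))\<^sup>2) + (\<Sum>j<L. (norm (tl L j))\<^sup>2)"
        using tl_l2[of L] by (intro suminf_split_initial_segment) (simp add: l2_space_def)
      also have "\<dots> = (\<Sum>j. (norm (u (j + L)))\<^sup>2)" by (simp add: tl_def)
      finally show ?thesis using suminf_split_initial_segment[OF sm, of L] by simp
    qed
    then have "l2_norm (tl L) = sqrt ((\<Sum>j. (norm (u j))\<^sup>2) - (\<Sum>j<L. (norm (u j))\<^sup>2))" for L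
      by (simp add: l2_norm_def)
    moreover have "(\<lambda>L. sqrt ((\<Sum>j. (norm (u j))\<^sup>2) - (\<Sum>j<L. (norm (u j))\<^sup>2))) \<longlonglongrightarrow> sqrt ((\<Sum>j. (norm (u j))\<^sup>2) - (\<Sum>j. (norm (u j))\<^sup>2))"
      by (intro tendsto_intros summable_LIMSEQ sm)
    ultimately show ?thesis by simp
  qed
  have "(\<lambda>L. T (tl L) k) \<longlonglongrightarrow> 0"
  proof (rule Lim_null_comparison)
    show "\<forall>\<^sub>F L in sequentially. norm (T (tl L) k) \<le> K * l2_norm (tl L)"
      using K(2) tl_l2 norm_le_l2_norm[OF bounded_l2_operatorD(1)[OF T tl_l2]]
      by (intro always_eventually allI) (meson order_trans)
    show "(\<lambda>L. K * l2_norm (tl L)) \<longlonglongrightarrow> 0" by (rule tendsto_mult_right_zero[OF tail])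
  qed
  then have "(\<lambda>L. T u k - T (tl L) k) \<longlonglongrightarrow> T u k - 0" by (intro tendsto_intros)
  moreover have "T u k - T (tl L) k = (\<Sum>l<L. T (single l (u l)) k)" for L
    using split[of L] tr_sum[of L] by simp
  ultimately show ?thesis by (simp add: sums_def)
qed

lemma op_entry_mult:
  assumes T: "bounded_l2_operator T"
  shows "op_entry T k n *v v = T (single n v) k"
proof -
  have "T (single n (c *s v + w)) k = c *s T (single n v) k + T (single n w) k" for c v w
  proof -
    have "single n (c *s v + w) = (\<lambda>j. c *s single n v j + single n w j)" by auto
    then show ?thesis by (simp only: bounded_l2_operatorD(2)[OF T single_l2 single_l2])
  qed
  moreover define f where "f v = T (single n v) k" for v
  ultimately have lin: "f (c *s v + w) = c *s f v + f w" for c v w by simp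
  have zero: "f 0 = 0" using lin[of 1 0 0] by simp
  have "Vector_Spaces.linear (*s) (*s) f"
    unfolding Vector_Spaces.linear_iff using lin[of 1] lin[of _ _ 0] zero
    by (simp add: vec.vector_space_axioms)
  from matrix_works[OF this] show ?thesis by (simp add: op_entry_def matrix_def f_def)
qed

lemma op_entry_matrix_op: "op_entry (matrix_op W) = W"
proof (intro ext)
  fix k n
  show "op_entry (matrix_op W) k n = W k n"
    unfolding op_entry_def matrix_op_single
    by (simp add: vec_eq_iff matrix_vector_mult_axis)
qed

lemma bounded_l2_operator_identity:
  assumes T: "bounded_l2_operator T" and u: "u \<in> l2_space"
    and id: "\<And>n v k. T (single n v) k = single n v k"
  shows "T u = u"
proof
  fix k
  have "(\<lambda>l. T (single l (u l)) k) sums T u k" by (rule bounded_l2_operator_expansion[OF T u])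
  moreover have "T (single l (u l)) k = (if l = k then u l else 0)" for l
    by (simp add: id)
  then have "(\<lambda>l. T (single l (u l)) k) sums u k"
    using sums_single[of k u] by (simp only:)
  ultimately show "T u k = u k" by (rule sums_unique2)
qed

section \<open>Resolvents and formal inverses\<close>

context band_pencil
begin

lemma matrix_op_band:
  assumes "\<And>l. k + r < l \<Longrightarrow> W k l = 0"
  shows "matrix_op W u k = (\<Sum>l\<le>k + r. W k l *v u l)"
  unfolding matrix_op_def by (rule suminf_finite) (use assms in auto)

lemma matrix_op_B: "matrix_op B v = (\<lambda>k. lam *s v k - matrix_op A v k)"
proof
  fix k
  have "(\<Sum>l\<le>k + r. (if k = l then mat lam else 0) *v v l) = (\<Sum>l\<le>k + r. if k = l then lam *s v l else 0)"
    by (intro sum.cong) (auto simp: mat_mult_vec)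
  then have "(\<Sum>l\<le>k + r. B k l *v v l) = lam *s v k - (\<Sum>l\<le>k + r. A k l *v v l)"
    by (simp add: B_def matrix_vector_mult_diff_rdistrib sum_subtractf)
  then show "matrix_op B v k = lam *s v k - matrix_op A v k"
    by (simp add: matrix_op_band A_zero B_zero)
qed

lemma is_resolvent_iff:
  "is_resolvent A lam T \<longleftrightarrow> bounded_l2_operator T \<and>
     (\<forall>u\<in>l2_space. matrix_op B (T u) = u) \<and> (\<forall>v\<in>l2_space. T (matrix_op B v) = v)"
  unfolding is_resolvent_def matrix_op_B ..

lemma is_resolvent_unique:
  assumes "is_resolvent A lam T" "is_resolvent A lam S" "u \<in> l2_space"
  shows "T u = S u"
proof -
  have "S u \<in> l2_space" using assms by (auto simp: is_resolvent_iff bounded_l2_operatorD(1))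
  then have "T (matrix_op B (S u)) = S u" using assms by (auto simp: is_resolvent_iff)
  moreover have "matrix_op B (S u) = u" using assms by (auto simp: is_resolvent_iff)
  ultimately show ?thesis by simp
qed

lemma is_resolvent_matrix_op:
  assumes X: "formal_inverse X" "decays c q X" and B: "decays b p B"
  shows "is_resolvent A lam (matrix_op X)"
  unfolding is_resolvent_iff
proof (intro conjI ballI)
  have bX: "bounded_l2_operator (matrix_op X)" and bB: "bounded_l2_operator (matrix_op B)"
    using X B decays_bounded_l2_operator by blast+
  show "bounded_l2_operator (matrix_op X)" by (rule bX)
  fix u :: "nat \<Rightarrow> complex^'n" assume u: "u \<in> l2_space"
  show "matrix_op B (matrix_op X u) = u"
  proof (rule bounded_l2_operator_identity[OF bounded_l2_operator_compose[OF bB bX] u])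
    fix n k and v :: "complex^'n"
    have "matrix_op B (matrix_op X (single n v)) k = (\<Sum>l\<le>k + r. B k l ** X l n) *v v"
      by (simp add: matrix_op_band B_zero matrix_op_single sum_matrix_vector_mult matrix_vector_mul_assoc)
    also have "\<dots> = single n v k" using X(1) by (simp add: formal_inverse_def)
    finally show "matrix_op B (matrix_op X (single n v)) k = single n v k" .
  qed
  show "matrix_op X (matrix_op B u) = u"
  proof (rule bounded_l2_operator_identity[OF bounded_l2_operator_compose[OF bX bB] u])
    fix n k and v :: "complex^'n"
    have "matrix_op X (matrix_op B (single n v)) k = (\<Sum>l\<le>n + s. X k l *v (B l n *v v))"
      unfolding matrix_op_def[of X] matrix_op_single by (rule suminf_finite) (auto simp: B_zero)
    also have "\<dots> = (\<Sum>l\<le>n + s. X k l ** B l n) *v v"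
      by (simp add: sum_matrix_vector_mult matrix_vector_mul_assoc)
    also have "\<dots> = single n v k" using X(1) by (simp add: formal_inverse_def)
    finally show "matrix_op X (matrix_op B (single n v)) k = single n v k" .
  qed
qed

text \<open>
  Apply \<open>B T = I\<close> and \<open>T B = I\<close> to sequences supported at \<open>n\<close>. Column \<open>n\<close> of \<open>B\<close> has finite support, so the
  expansion of \<open>T\<close> along it is a finite sum.
\<close>

lemma formal_inverse_op_entry:
  assumes T: "is_resolvent A lam T" and B: "decays b p B"
  shows "formal_inverse (op_entry T)"
proof -
  have bT: "bounded_l2_operator T" and BT: "\<And>u. u \<in> l2_space \<Longrightarrow> matrix_op B (T u) = u"
    and TB: "\<And>v. v \<in> l2_space \<Longrightarrow> T (matrix_op B v) = v"
    using T by (auto simp: is_resolvent_iff)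
  have right: "(\<Sum>l\<le>k + r. B k l ** op_entry T l n) = (if k = n then mat 1 else 0)" for k n
    unfolding matrix_eq
  proof
    fix v
    have "(\<Sum>l\<le>k + r. B k l ** op_entry T l n) *v v = matrix_op B (T (single n v)) k"
      by (simp add: matrix_op_band B_zero sum_matrix_vector_mult matrix_vector_mul_assoc[symmetric]
          op_entry_mult[OF bT])
    then show "(\<Sum>l\<le>k + r. B k l ** op_entry T l n) *v v = (if k = n then mat 1 else 0) *v v"
      by (simp add: BT[OF single_l2])
  qed
  have left: "(\<Sum>l\<le>n + s. op_entry T k l ** B l n) = (if k = n then mat 1 else 0)" for k n
    unfolding matrix_eq
  proof
    fix v
    let ?w = "matrix_op B (single n v)"
    have w: "?w l = B l n *v v" for l by (rule matrix_op_single)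
    have "(\<lambda>l. T (single l (?w l)) k) sums T ?w k"
      by (rule bounded_l2_operator_expansion[OF bT decays_matrix_op(2)[OF B single_l2]])
    moreover have "(\<lambda>l. T (single l (?w l)) k) sums (\<Sum>l\<le>n + s. T (single l (?w l)) k)"
    proof (rule sums_finite)
      fix l assume "l \<notin> {..n + s}"
      then have "?w l = 0" by (simp add: w B_zero)
      then show "T (single l (?w l)) k = 0"
        by (metis op_entry_mult[OF bT] matrix_vector_mult_0_right)
    qed simp
    ultimately have "T ?w k = (\<Sum>l\<le>n + s. T (single l (?w l)) k)" by (rule sums_unique2)
    also have "\<dots> = (\<Sum>l\<le>n + s. op_entry T k l ** B l n) *v v"
      by (simp only: op_entry_mult[OF bT, symmetric] w sum_matrix_vector_mult matrix_vector_mul_assoc)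
    finally have "(\<Sum>l\<le>n + s. op_entry T k l ** B l n) *v v = single n v k"
      by (simp only: TB[OF single_l2])
    then show "(\<Sum>l\<le>n + s. op_entry T k l ** B l n) *v v = (if k = n then mat 1 else 0) *v v"
      by simp
  qed
  show ?thesis by (simp add: formal_inverse_def right left)
qed

text \<open>
  The Combes-Thomas estimate. Let \<open>x\<close> be column \<open>n\<close> of the resolvent and \<open>y = w x\<close> with the weight
  \<open>w\<^sub>k = p\<^bsup>\<bar>k - n\<bar>\<^esup>\<close>, \<open>p > 1\<close>. Then \<open>B y = e\<^sub>n + E y\<close>, where the commutator \<open>E\<^bsub>k,l\<^esub> = (w\<^sub>k / w\<^sub>l - 1) A\<^bsub>k,l\<^esub>\<close> is
  small for \<open>p\<close> close to \<open>1\<close>, since \<open>w\<^sub>k / w\<^sub>l\<close> is close to \<open>1\<close> within the band. Hence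
  \<open>y = T (e\<^sub>n + E y)\<close> with \<open>T E\<close> a contraction, so \<open>y\<close> is bounded uniformly in \<open>n\<close>, which is exponential decay
  of \<open>x\<close>. The weight is capped at the distance \<open>L\<close> of the block under consideration, so that \<open>y\<close> is
  square-summable; no estimate depends on \<open>L\<close>.
\<close>

lemma resolvent_decays:
  assumes T: "is_resolvent A lam T" and a: "\<And>k l. norm (A k l) \<le> a"
  shows "\<exists>c q. decays c q (op_entry T)"
proof -
  have bT: "bounded_l2_operator T" and BT: "\<And>u. u \<in> l2_space \<Longrightarrow> matrix_op B (T u) = u"
    and TB: "\<And>v. v \<in> l2_space \<Longrightarrow> T (matrix_op B v) = v"
    using T by (auto simp: is_resolvent_iff)
  obtain K where K: "0 < K" "\<And>u. u \<in> l2_space \<Longrightarrow> l2_norm (T u) \<le> K * l2_norm u"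
    using bounded_l2_operatorD(3)[OF bT] by blast
  define d where "d = r + s"
  have d: "0 < d" using r_pos by (simp add: d_def)
  \<comment> \<open>By the Schur test, \<open>E\<close> has norm at most \<open>\<epsilon> * \<kappa>\<close> when the weight ratios differ from \<open>1\<close> by at most \<open>\<epsilon>\<close>;
    with this choice of \<open>\<epsilon>\<close> the norm of \<open>T E\<close> is at most \<open>1/2\<close>. The summand \<open>1\<close> ensures \<open>\<kappa> > 0\<close>.\<close>
  define \<kappa> where "\<kappa> = (real CARD('n))\<^sup>2 * (a + 1) * 2 ^ d * 4"
  have a0: "0 \<le> a" using a[of 0 0] norm_ge_zero order_trans by blast
  have \<kappa>: "0 < \<kappa>" using a0 by (simp add: \<kappa>_def)
  define \<epsilon> where "\<epsilon> = 1 / (2 * K * \<kappa>)"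
  have \<epsilon>: "0 < \<epsilon>" using K \<kappa> by (simp add: \<epsilon>_def)
  define p where "p = root d (1 + \<epsilon>)"
  have p: "1 < p" "p ^ d = 1 + \<epsilon>"
    using d \<epsilon> by (simp_all add: p_def)
  have main: "norm (T (single n v) k0) \<le> 2 * K * (1 / p) ^ nat \<bar>int k0 - int n\<bar> * norm v" for n v k0
  proof -
    define L where "L = nat \<bar>int k0 - int n\<bar>"
    define w where "w k = p ^ min (nat \<bar>int k - int n\<bar>) L" for k
    define x where "x = T (single n v)"
    define y where "y k = complex_of_real (w k) *s x k" for k
    define E where "E k l = mat (complex_of_real (w k / w l - 1)) ** A k l" for k l
    have w0: "0 < w k" for k using p by (simp add: w_def)
    have w_le: "w k \<le> (1 + \<epsilon>) * w l" if "k \<le> l + d" "l \<le> k + d" for k l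
    proof -
      have "w k \<le> p ^ (d + min (nat \<bar>int l - int n\<bar>) L)"
        unfolding w_def using p that by (intro power_increasing) auto
      then show ?thesis by (simp add: power_add p w_def)
    qed
    have w_quot: "\<bar>w k / w l - 1\<bar> \<le> \<epsilon>" if kl: "k \<le> l + d" "l \<le> k + d" for k l
    proof -
      have "w k / w l \<le> 1 + \<epsilon>" using w_le[OF kl] w0[of l] by (simp add: field_simps)
      moreover have "1 - \<epsilon> \<le> w k / w l"
      proof -
        have "(1 - \<epsilon>) * w l \<le> (1 - \<epsilon>) * ((1 + \<epsilon>) * w k)" if "\<epsilon> \<le> 1"
          using w_le[OF kl(2,1)] that by (intro mult_left_mono) auto
        also have "(1 - \<epsilon>) * ((1 + \<epsilon>) * w k) = w k - \<epsilon>\<^sup>2 * w k"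
          by (simp add: algebra_simps power2_eq_square)
        also have "\<dots> \<le> w k" using w0[of k] by simp
        finally have "\<epsilon> \<le> 1 \<Longrightarrow> (1 - \<epsilon>) * w l \<le> w k" .
        moreover have "\<not> \<epsilon> \<le> 1 \<Longrightarrow> (1 - \<epsilon>) * w l \<le> w k"
          using mult_nonpos_nonneg[of "1 - \<epsilon>" "w l"] w0[of l] w0[of k] by simp
        ultimately show ?thesis using w0[of l] by (cases "\<epsilon> \<le> 1") (auto simp: field_simps)
      qed
      ultimately show ?thesis by linarith
    qed
    have x: "x \<in> l2_space" unfolding x_def by (rule bounded_l2_operatorD(1)[OF bT single_l2])
    have norm_y: "norm (y k) = w k * norm (x k)" for k
      using w0[of k] by (simp add: y_def norm_vec_def norm_mult L2_set_left_distrib[symmetric] L2_set_right_distrib[symmetric])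
    have y: "y \<in> l2_space"
    proof (rule l2_weighted[OF x])
      show "norm (y k) \<le> p ^ L * norm (x k)" for k
        unfolding norm_y w_def using p by (intro mult_right_mono power_increasing) auto
    qed
    have dE: "decays ((real CARD('n))\<^sup>2 * (\<epsilon> * (a + 1)) * 2 ^ d) (1 / 2) E"
    proof (rule banded_decays)
      show E0: "E k l = 0" if "l + d < k \<or> k + d < l" for k l
        using that by (auto simp: E_def d_def A_zero)
      show "norm (E k l) \<le> \<epsilon> * (a + 1)" for k l
      proof (cases "l + d < k \<or> k + d < l")
        case False
        then have "\<bar>w k / w l - 1\<bar> * norm (A k l) \<le> \<epsilon> * (a + 1)"
          using a[of k l] \<epsilon> by (intro mult_mono w_quot) auto
        then show ?thesis unfolding E_def norm_mat_of_real_mult .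
      qed (use E0 \<epsilon> a0 in auto)
    qed
    note Ey = decays_matrix_op(2,3)[OF dE y]
    have "matrix_op B y = (\<lambda>k. single n v k + matrix_op E y k)"
    proof
      fix k
      \<comment> \<open>\<open>B\<close> and \<open>- A\<close> differ on the diagonal only, where the weights cancel.\<close>
      have term_eq: "B k l *v y l = complex_of_real (w k) *s (B k l *v x l) + E k l *v y l" for l
      proof -
        have "E k l *v y l = (complex_of_real (w k) - complex_of_real (w l)) *s (A k l *v x l)"
        proof -
          have "complex_of_real (w l) * complex_of_real (w k / w l - 1) =
              complex_of_real (w k) - complex_of_real (w l)"
            using w0[of l] by (simp add: right_diff_distrib)
          then show ?thesis
            by (simp only: E_def y_def matrix_vector_mul_assoc[symmetric] mat_mult_vec
                vector_scalar_commute vector_smult_assoc)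
        qed
        moreover have "(- A k l) *v x l = - (A k l *v x l)"
          using matrix_vector_mult_diff_rdistrib[of 0 "A k l" "x l"] by simp
        then have "(complex_of_real (w l) - complex_of_real (w k)) *s (B k l *v x l) =
            (complex_of_real (w k) - complex_of_real (w l)) *s (A k l *v x l)"
          by (cases "k = l") (auto simp: B_def vec_eq_iff algebra_simps)
        ultimately have "E k l *v y l = (complex_of_real (w l) - complex_of_real (w k)) *s (B k l *v x l)"
          by (simp only:)
        then show ?thesis
          by (simp only: y_def vector_scalar_commute vec_eq_iff) (simp add: algebra_simps)
      qed
      have "w n = 1" by (simp add: w_def)
      then have "single n v k = complex_of_real (w k) *s matrix_op B x k"
        by (simp add: x_def BT[OF single_l2])
      then show "matrix_op B y k = single n v k + matrix_op E y k"
        by (simp add: matrix_op_band B_zero E_def A_zero term_eq[unfolded E_def] sum.distrib vec.scale_sum_right)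
    qed
    moreover have "(\<lambda>k. single n v k + matrix_op E y k) \<in> l2_space"
      by (rule l2_add(1)[OF single_l2 Ey(1)])
    ultimately have "l2_norm y \<le> K * l2_norm (\<lambda>k. single n v k + matrix_op E y k)"
      using K(2) TB[OF y] by metis
    then have "(l2_norm y)\<^sup>2 \<le> K\<^sup>2 * (l2_norm (\<lambda>k. single n v k + matrix_op E y k))\<^sup>2"
      unfolding power_mult_distrib[symmetric] by (intro power_mono l2_norm_nonneg[OF y])
    also have "\<dots> \<le> K\<^sup>2 * (2 * (norm v)\<^sup>2 + 2 * (l2_norm (matrix_op E y))\<^sup>2)"
      using l2_add(2)[OF single_l2 Ey(1), of n v] by (intro mult_left_mono) (auto simp: l2_norm_single)
    also have "\<dots> \<le> K\<^sup>2 * (2 * (norm v)\<^sup>2 + 2 * (\<epsilon> * \<kappa> * l2_norm y)\<^sup>2)"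
      using Ey(2) by (intro mult_left_mono add_left_mono power_mono l2_norm_nonneg[OF Ey(1)])
        (auto simp: \<kappa>_def mult_ac)
    also have "\<dots> = 2 * K\<^sup>2 * (norm v)\<^sup>2 + (l2_norm y)\<^sup>2 / 2"
      using K \<kappa> by (simp add: \<epsilon>_def power_mult_distrib power_divide field_simps)
    \<comment> \<open>The term \<open>(l2_norm y)\<^sup>2 / 2\<close> is absorbed into the left-hand side.\<close>
    finally have "(l2_norm y)\<^sup>2 \<le> (2 * K * norm v)\<^sup>2" by (simp add: power_mult_distrib)
    then have "l2_norm y \<le> 2 * K * norm v"
      using K by (intro power2_le_imp_le[of "l2_norm y"]) auto
    then have "w k0 * norm (x k0) \<le> 2 * K * norm v"
      using norm_le_l2_norm[OF y, of k0] by (simp add: norm_y)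
    then show ?thesis
      using p(1) by (simp add: w_def L_def x_def power_divide field_simps)
  qed
  then have "decays (2 * K) (1 / p) (op_entry T)"
    using K p by (simp add: decays_def op_entry_mult[OF bT])
  then show ?thesis by blast
qed

lemma B_decays:
  assumes a: "\<And>k l. norm (A k l) \<le> a"
  shows "\<exists>b p. decays b p B"
proof -
  have "norm (B k l) \<le> norm (mat lam :: complex^'n^'n) + a" for k l
    using a[of k l] norm_triangle_ineq4[of "mat lam" "A k l"]
    by (auto simp: B_def intro: add_increasing)
  then have "decays ((real CARD('n))\<^sup>2 * (norm (mat lam :: complex^'n^'n) + a) * 2 ^ (r + s)) (1 / 2) B"
    by (rule banded_decays) (auto simp: B_zero)
  then show ?thesis by blast
qed

lemma exp_decay_iff:
  assumes "is_matrix_norm \<nu>"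
  shows "exp_decay \<nu> r s A lam M \<longleftrightarrow> (\<exists>c q. decays c q (R_entry r s A lam M))"
proof
  let ?R = "R_entry r s A lam M" and ?N = "(real CARD('n))\<^sup>2"
  obtain c0 where c0: "0 < c0" "\<And>X. \<nu> X \<le> c0 * norm X" "\<And>X. norm X \<le> c0 * \<nu> X"
    using matrix_norm_equivalent[OF assms] by blast
  {
    assume "exp_decay \<nu> r s A lam M"
    then obtain C q where Cq: "0 < C" "0 < q" "q < 1"
      "\<And>k n. \<nu> (?R k n) \<le> C * q ^ nat \<bar>int n - int k\<bar>"
      by (auto simp: exp_decay_def)
    have "norm (?R k n *v v) \<le> ?N * c0 * C * q ^ nat \<bar>int k - int n\<bar> * norm v" for k n v
    proof -
      have "norm (?R k n) \<le> c0 * (C * q ^ nat \<bar>int k - int n\<bar>)"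
        using order_trans[OF c0(3)[of "?R k n"] mult_left_mono[OF Cq(4)[of k n], of c0]] c0(1)
        by (simp add: abs_minus_commute)
      then have "?N * norm (?R k n) * norm v \<le> ?N * (c0 * (C * q ^ nat \<bar>int k - int n\<bar>)) * norm v"
        by (intro mult_right_mono mult_left_mono) auto
      from order_trans[OF norm_matrix_vector_mult_le this] show ?thesis by (simp add: mult.assoc)
    qed
    then have "decays (?N * c0 * C) q ?R" using Cq c0(1) by (simp add: decays_def)
    then show "\<exists>c q. decays c q ?R" by blast
  }
  {
    assume "\<exists>c q. decays c q ?R"
    then obtain c q where cq: "0 \<le> c" "0 < q" "q < 1"
      "\<And>k n v. norm (?R k n *v v) \<le> c * q ^ nat \<bar>int k - int n\<bar> * norm v"
      by (auto simp: decays_def)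
    have "\<nu> (?R k n) \<le> (c0 * ?N * c + 1) * q ^ nat \<bar>int n - int k\<bar>" for k n
    proof -
      have "norm (?R k n) \<le> ?N * (c * q ^ nat \<bar>int k - int n\<bar>)"
      proof (rule norm_matrix_le_of_columns)
        show "norm (?R k n *v axis b 1) \<le> c * q ^ nat \<bar>int k - int n\<bar>" for b
          using cq(4)[of k n "axis b 1"] by simp
      qed
      then have "\<nu> (?R k n) \<le> c0 * (?N * (c * q ^ nat \<bar>int k - int n\<bar>))"
        using c0(1) by (intro order_trans[OF c0(2) mult_left_mono]) auto
      also have "\<dots> \<le> (c0 * ?N * c + 1) * q ^ nat \<bar>int k - int n\<bar>"
        using cq(2) by (simp add: distrib_right mult.assoc)
      finally show ?thesis by (simp add: abs_minus_commute)
    qed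
    moreover have "0 < c0 * ?N * c + 1" using c0(1) cq(1) by (intro add_nonneg_pos mult_nonneg_nonneg) auto
    ultimately show "exp_decay \<nu> r s A lam M" using cq unfolding exp_decay_def by blast
  }
qed

lemma resolvent_gives_decaying_R_entry:
  assumes T: "is_resolvent A lam T" and a: "\<And>k l. norm (A k l) \<le> a"
  shows "\<exists>M\<in>block_matrices r s. \<exists>c q. decays c q (R_entry r s A lam M)"
proof
  obtain b p where B: "decays b p B" using B_decays[OF a] by blast
  let ?M = "\<lambda>i j. if i < r \<and> j < s then op_entry T i j else 0"
  show "?M \<in> block_matrices r s" by (auto simp: block_matrices_def)
  have "op_entry T = R_entry r s A lam ?M"
    by (intro ext formal_inverse_eq_R_entry[OF formal_inverse_op_entry[OF T B]]) simp
  then show "\<exists>c q. decays c q (R_entry r s A lam ?M)"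
    using resolvent_decays[OF T a] by simp
qed

lemma weyl_matrix_eq:
  assumes M: "M \<in> block_matrices r s" and R: "is_resolvent A lam (matrix_op (R_entry r s A lam M))"
  shows "M = weyl_matrix r s A lam"
proof (intro ext)
  fix i j
  have "is_resolvent A lam (resolvent_op A lam)"
    unfolding resolvent_op_def by (rule someI[where P = "is_resolvent A lam", OF R])
  then have "op_entry (resolvent_op A lam) = op_entry (matrix_op (R_entry r s A lam M))"
    unfolding op_entry_def using is_resolvent_unique[OF _ R single_l2] by simp
  then show "M i j = weyl_matrix r s A lam i j"
    using M by (auto simp: weyl_matrix_def op_entry_matrix_op R_entry_corner block_matrices_def)
qed

end

theorem theorem1:
  fixes A :: "nat \<Rightarrow> nat \<Rightarrow> complex^'n^'n"
    and r s :: nat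
    and lam :: complex
    and \<nu> :: "complex^'n^'n \<Rightarrow> real"
  assumes "0 < r" and "0 < s"
    and "is_matrix_norm \<nu>"
    and "band_matrix r s A"
    and "bdd_above (range (\<lambda>(i, j). \<nu> (A i j)))"

  shows "(lam \<in> resolvent_set A \<longleftrightarrow> (\<exists>M \<in> block_matrices r s. exp_decay \<nu> r s A lam M)) \<and>
    (lam \<in> resolvent_set A \<longrightarrow>
      (\<exists>!M. M \<in> block_matrices r s \<and> exp_decay \<nu> r s A lam M) \<and>
      (\<forall>M \<in> block_matrices r s. exp_decay \<nu> r s A lam M \<longrightarrow>
        (\<forall>i<r. \<forall>j<s. M i j = R_entry r s A lam M i j) \<and> M = weyl_matrix r s A lam))"
proof -
  interpret band_pencil r s A lam using assms by unfold_locales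
  obtain C where C: "\<And>i j. \<nu> (A i j) \<le> C"
    using assms(5) by (auto simp: bdd_above_def)
  obtain c where "0 < c" "\<And>X. norm X \<le> c * \<nu> X"
    using matrix_norm_equivalent[OF assms(3)] by blast
  then have a: "norm (A i j) \<le> c * C" for i j
    using mult_left_mono[OF C[of i j], of c] by (meson less_imp_le order_trans)
  obtain b p where B: "decays b p B" using B_decays[OF a] by blast
  have resolvent: "is_resolvent A lam (matrix_op (R_entry r s A lam M))"
    if "exp_decay \<nu> r s A lam M" for M
    using that is_resolvent_matrix_op[OF formal_inverse_R_entry _ B]
    unfolding exp_decay_iff[OF assms(3)] by blast
  have exists: "\<exists>M\<in>block_matrices r s. exp_decay \<nu> r s A lam M" if "lam \<in> resolvent_set A"
    using that resolvent_gives_decaying_R_entry[OF _ a]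
    unfolding exp_decay_iff[OF assms(3)] resolvent_set_def by blast
  have weyl: "M = weyl_matrix r s A lam"
    if "M \<in> block_matrices r s" "exp_decay \<nu> r s A lam M" for M
    using weyl_matrix_eq[OF that(1) resolvent[OF that(2)]] .
  have "lam \<in> resolvent_set A" if "exp_decay \<nu> r s A lam M" for M
    using resolvent[OF that] unfolding resolvent_set_def by blast
  then show ?thesis
    using exists weyl R_entry_corner by metis
qed

end
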